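(* Let $m, n \in \mathbb{Z}_{\geq 1}\cup\{\infty\}$, let $G$ be a metacyclic group admitting a short exact sequence of groups $$1 \to C_m \to G \to C_n \to 1,$$ and let $R$ be any commutative ring. Suppose that one of the following is true: (1) $m, n \in \mathbb{Z}_{\geq 1}$ are coprime; (2) $n$ is a prime; (3) $m$ is a prime. Then for every subgroup $H \leq G$, $$\mathrm{N}_{\mathrm{U}(RG)}(H) = \mathrm{N}_G(H)\cdot \mathrm{C}_{\mathrm{U}(RG)}(H).$$
   Context: $C_k$ denotes the cyclic group of order $k$ for $k \in \mathbb{Z}_{\geq 1}$, and $C_\infty$ the infinite cyclic group. Rings have an identity element $1$, and $R \neq 0$. $RG$ is the group ring of $G$ over $R$ and $\mathrm{U}(RG)$ its group of units; $G$ is regarded as a subgroup of $\mathrm{U}(RG)$. For a group $X$ containing $H$ as a subgroup, $\mathrm{N}_X(H)=\{x\in X : x^{-1}Hx=H\}$ is the normalizer and $\mathrm{C}_X(H)$ the centralizer of $H$ in $X$. *)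

theory Defs
  imports "HOL-Algebra.Algebra" "HOL-Library.Extended_Nat"
begin

text \<open>The cyclic group $C_k$, with \<open>\<infinity>\<close> giving the infinite cyclic group. The value at \<open>0\<close> is not
  meaningful (\<open>integer_mod_group 0\<close> is the infinite cyclic group); uses require \<open>1 \<le> k\<close>.\<close>

definition cyclic_grp :: "enat \<Rightarrow> int monoid"
  where "cyclic_grp k = (case k of enat j \<Rightarrow> integer_mod_group j | \<infinity> \<Rightarrow> integer_group)"

text \<open>An element $\sum_g a_g g$ of the group ring is represented by its coefficient function, required
  to be zero off \<open>carrier G\<close> so that equality of functions is equality in the group ring. In the
  product, the coefficient of \<open>x\<close> is $\sum_y a_y b_{y^{-1}x}$; the sum ranges over the (finite)
  support of \<open>a\<close>, because \<^const>\<open>finsum\<close> over an infinite set is not meaningful.\<close>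

definition group_ring ::
    "('r, 'm) ring_scheme \<Rightarrow> ('g, 'n) monoid_scheme \<Rightarrow> ('g \<Rightarrow> 'r) ring"
  where "group_ring R G =
    \<lparr>carrier = {a. (\<forall>x \<in> carrier G. a x \<in> carrier R) \<and> (\<forall>x. x \<notin> carrier G \<longrightarrow> a x = \<zero>\<^bsub>R\<^esub>) \<and>
                   finite {x \<in> carrier G. a x \<noteq> \<zero>\<^bsub>R\<^esub>}},
     monoid.mult = (\<lambda>a b x. if x \<in> carrier G
        then (\<Oplus>\<^bsub>R\<^esub>y \<in> {y \<in> carrier G. a y \<noteq> \<zero>\<^bsub>R\<^esub>}. a y \<otimes>\<^bsub>R\<^esub> b (inv\<^bsub>G\<^esub> y \<otimes>\<^bsub>G\<^esub> x))
        else \<zero>\<^bsub>R\<^esub>),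
     monoid.one = (\<lambda>x. if x = \<one>\<^bsub>G\<^esub> then \<one>\<^bsub>R\<^esub> else \<zero>\<^bsub>R\<^esub>),
     ring.zero = (\<lambda>x. \<zero>\<^bsub>R\<^esub>),
     ring.add = (\<lambda>a b x. a x \<oplus>\<^bsub>R\<^esub> b x)\<rparr>"

text \<open>The group element \<open>g\<close> regarded as an element of the group ring.\<close>

definition group_elt :: "('r, 'm) ring_scheme \<Rightarrow> 'g \<Rightarrow> 'g \<Rightarrow> 'r"
  where "group_elt R g = (\<lambda>x. if x = g then \<one>\<^bsub>R\<^esub> else \<zero>\<^bsub>R\<^esub>)"

definition centralizer :: "('a, 'b) monoid_scheme \<Rightarrow> 'a set \<Rightarrow> 'a set"
  where "centralizer U H = {x \<in> carrier U. \<forall>h \<in> H. x \<otimes>\<^bsub>U\<^esub> h = h \<otimes>\<^bsub>U\<^esub> x}"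

lemma (in group) conj_set_cancel:
  assumes "x \<in> carrier G" "H \<subseteq> carrier G"
  shows "inv x <# (x <# H #> inv x) #> x = H"
proof -
  have "inv x \<otimes> (x \<otimes> h \<otimes> inv x) \<otimes> x = h" if "h \<in> H" for h
    using assms that by (auto simp: m_assoc subset_iff inv_solve_left' simp flip: m_assoc[of "inv x" x])
  then show ?thesis
    unfolding l_coset_def r_coset_def by auto
qed

text \<open>The library's normalizer, defined by \<open>x H x\<^sup>-\<^sup>1 = H\<close>, is the set given by \<open>x\<^sup>-\<^sup>1 H x = H\<close>.\<close>

lemma (in group) normalizer_eq:
  assumes H: "H \<subseteq> carrier G"
  shows "normalizer G H = {x \<in> carrier G. inv x <# H #> x = H}"
proof -
  have "x <# H #> inv x = H \<longleftrightarrow> inv x <# H #> x = H" if x: "x \<in> carrier G" for x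
    using conj_set_cancel[OF x H] conj_set_cancel[OF inv_closed[OF x] H] x by auto
  then show ?thesis
    using H by (auto simp: normalizer_def stabilizer_def)
qed

locale group_ring_setup = R: cring R + G: group G
  for R :: "('r, 'm) ring_scheme" and G :: "('g, 'n) monoid_scheme"
begin

abbreviation "RG \<equiv> group_ring R G"
abbreviation supp where "supp a \<equiv> {x \<in> carrier G. a x \<noteq> \<zero>\<^bsub>R\<^esub>}"

lemma RG_closed: "a \<in> carrier RG \<Longrightarrow> a x \<in> carrier R"
  by (cases "x \<in> carrier G") (auto simp: group_ring_def)

lemma RG_finite: "a \<in> carrier RG \<Longrightarrow> finite (supp a)"
  by (simp add: group_ring_def)

lemma RG_zero: "a \<in> carrier RG \<Longrightarrow> x \<notin> carrier G \<Longrightarrow> a x = \<zero>\<^bsub>R\<^esub>"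
  by (auto simp: group_ring_def)

lemma RG_I:
  assumes "\<And>x. x \<in> carrier G \<Longrightarrow> a x \<in> carrier R" "\<And>x. x \<notin> A \<Longrightarrow> a x = \<zero>\<^bsub>R\<^esub>"
    "finite A" "A \<subseteq> carrier G"
  shows "a \<in> carrier RG"
proof -
  have "supp a \<subseteq> A" using assms by auto
  with assms show ?thesis by (auto simp: group_ring_def intro: finite_subset)
qed

lemma mult_eq:
  assumes a: "a \<in> carrier RG" and b: "b \<in> carrier RG"
    and A: "finite A" "A \<subseteq> carrier G" "supp a \<subseteq> A" and x: "x \<in> carrier G"
  shows "(a \<otimes>\<^bsub>RG\<^esub> b) x = (\<Oplus>\<^bsub>R\<^esub>y \<in> A. a y \<otimes>\<^bsub>R\<^esub> b (inv\<^bsub>G\<^esub> y \<otimes>\<^bsub>G\<^esub> x))"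
proof -
  have "(a \<otimes>\<^bsub>RG\<^esub> b) x = (\<Oplus>\<^bsub>R\<^esub>y \<in> supp a. a y \<otimes>\<^bsub>R\<^esub> b (inv\<^bsub>G\<^esub> y \<otimes>\<^bsub>G\<^esub> x))"
    using x by (simp add: group_ring_def)
  also have "\<dots> = (\<Oplus>\<^bsub>R\<^esub>y \<in> A. a y \<otimes>\<^bsub>R\<^esub> b (inv\<^bsub>G\<^esub> y \<otimes>\<^bsub>G\<^esub> x))"
    by (rule R.add.finprod_mono_neutral_cong_left)
      (use A RG_closed[OF a] RG_closed[OF b] RG_zero[OF a] in auto)
  finally show ?thesis .
qed

lemma mult_out: "x \<notin> carrier G \<Longrightarrow> (a \<otimes>\<^bsub>RG\<^esub> b) x = \<zero>\<^bsub>R\<^esub>"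
  by (simp add: group_ring_def)

lemma mult_supp:
  assumes a: "a \<in> carrier RG" and b: "b \<in> carrier RG"
    and x: "x \<notin> supp a <#>\<^bsub>G\<^esub> supp b"
  shows "(a \<otimes>\<^bsub>RG\<^esub> b) x = \<zero>\<^bsub>R\<^esub>"
proof (cases "x \<in> carrier G")
  case True
  have "b (inv\<^bsub>G\<^esub> y \<otimes>\<^bsub>G\<^esub> x) = \<zero>\<^bsub>R\<^esub>" if y: "y \<in> supp a" for y
  proof (rule ccontr)
    assume "b (inv\<^bsub>G\<^esub> y \<otimes>\<^bsub>G\<^esub> x) \<noteq> \<zero>\<^bsub>R\<^esub>"
    then have "inv\<^bsub>G\<^esub> y \<otimes>\<^bsub>G\<^esub> x \<in> supp b" using y True by auto
    moreover have "y \<otimes>\<^bsub>G\<^esub> (inv\<^bsub>G\<^esub> y \<otimes>\<^bsub>G\<^esub> x) = x"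
      using y True by (simp flip: G.m_assoc)
    ultimately have "x \<in> supp a <#>\<^bsub>G\<^esub> supp b"
      using y unfolding set_mult_def by force
    with x show False by contradiction
  qed
  then have "(\<Oplus>\<^bsub>R\<^esub>y \<in> supp a. a y \<otimes>\<^bsub>R\<^esub> b (inv\<^bsub>G\<^esub> y \<otimes>\<^bsub>G\<^esub> x)) = (\<Oplus>\<^bsub>R\<^esub>y \<in> supp a. \<zero>\<^bsub>R\<^esub>)"
    by (intro R.finsum_cong') (use RG_closed[OF a] in auto)
  then show ?thesis
    using mult_eq[OF a b RG_finite[OF a] _ _ True] by simp
qed (simp add: mult_out)

lemma supp_prod: "a \<in> carrier RG \<Longrightarrow> b \<in> carrier RG \<Longrightarrow>
    finite (supp a <#>\<^bsub>G\<^esub> supp b) \<and> supp a <#>\<^bsub>G\<^esub> supp b \<subseteq> carrier G"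
  unfolding set_mult_def using RG_finite by auto

lemma mult_closed:
  assumes a: "a \<in> carrier RG" and b: "b \<in> carrier RG"
  shows "a \<otimes>\<^bsub>RG\<^esub> b \<in> carrier RG"
proof (rule RG_I[where A = "supp a <#>\<^bsub>G\<^esub> supp b"])
  show "(a \<otimes>\<^bsub>RG\<^esub> b) x \<in> carrier R" if "x \<in> carrier G" for x
    using mult_eq[OF a b RG_finite[OF a] _ _ that] RG_closed[OF a] RG_closed[OF b]
    by (auto intro!: R.finsum_closed)
qed (use mult_supp[OF a b] supp_prod[OF a b] in auto)

lemma finsum_swap:
  assumes "finite P" "finite A" "\<And>z y. f z y \<in> carrier R"
  shows "(\<Oplus>\<^bsub>R\<^esub>z \<in> P. \<Oplus>\<^bsub>R\<^esub>y \<in> A. f z y) = (\<Oplus>\<^bsub>R\<^esub>y \<in> A. \<Oplus>\<^bsub>R\<^esub>z \<in> P. f z y)"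
  using assms(1)
proof induction
  case (insert z P)
  then show ?case
    using assms(2,3) by (simp add: R.finsum_insert R.finsum_addf Pi_iff)
qed simp

lemma mult_assoc:
  assumes a: "a \<in> carrier RG" and b: "b \<in> carrier RG" and c: "c \<in> carrier RG"
  shows "(a \<otimes>\<^bsub>RG\<^esub> b) \<otimes>\<^bsub>RG\<^esub> c = a \<otimes>\<^bsub>RG\<^esub> (b \<otimes>\<^bsub>RG\<^esub> c)"
proof
  fix x
  show "((a \<otimes>\<^bsub>RG\<^esub> b) \<otimes>\<^bsub>RG\<^esub> c) x = (a \<otimes>\<^bsub>RG\<^esub> (b \<otimes>\<^bsub>RG\<^esub> c)) x"
  proof (cases "x \<in> carrier G")
    case x: True
    define A B P where "A = supp a" and "B = supp b" and "P = supp a <#>\<^bsub>G\<^esub> supp b"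
    have fin: "finite A" "finite B" "finite P" and sub: "A \<subseteq> carrier G" "B \<subseteq> carrier G" "P \<subseteq> carrier G"
      using RG_finite[OF a] RG_finite[OF b] supp_prod[OF a b] by (auto simp: A_def B_def P_def)
    have suppP: "supp (a \<otimes>\<^bsub>RG\<^esub> b) \<subseteq> P"
      using mult_supp[OF a b] by (auto simp: P_def)
    note cl = RG_closed[OF a] RG_closed[OF b] RG_closed[OF c]
    have "((a \<otimes>\<^bsub>RG\<^esub> b) \<otimes>\<^bsub>RG\<^esub> c) x
        = (\<Oplus>\<^bsub>R\<^esub>z \<in> P. (a \<otimes>\<^bsub>RG\<^esub> b) z \<otimes>\<^bsub>R\<^esub> c (inv\<^bsub>G\<^esub> z \<otimes>\<^bsub>G\<^esub> x))"
      by (rule mult_eq[OF mult_closed[OF a b] c fin(3) sub(3) suppP x])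
    also have "\<dots> = (\<Oplus>\<^bsub>R\<^esub>z \<in> P. \<Oplus>\<^bsub>R\<^esub>y \<in> A. a y \<otimes>\<^bsub>R\<^esub> b (inv\<^bsub>G\<^esub> y \<otimes>\<^bsub>G\<^esub> z) \<otimes>\<^bsub>R\<^esub> c (inv\<^bsub>G\<^esub> z \<otimes>\<^bsub>G\<^esub> x))"
    proof (rule R.finsum_cong', simp)
      fix z assume z: "z \<in> P"
      then have "(a \<otimes>\<^bsub>RG\<^esub> b) z = (\<Oplus>\<^bsub>R\<^esub>y \<in> A. a y \<otimes>\<^bsub>R\<^esub> b (inv\<^bsub>G\<^esub> y \<otimes>\<^bsub>G\<^esub> z))"
        using mult_eq[OF a b fin(1) sub(1)] sub by (auto simp: A_def)
      then show "(a \<otimes>\<^bsub>RG\<^esub> b) z \<otimes>\<^bsub>R\<^esub> c (inv\<^bsub>G\<^esub> z \<otimes>\<^bsub>G\<^esub> x) =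
          (\<Oplus>\<^bsub>R\<^esub>y \<in> A. a y \<otimes>\<^bsub>R\<^esub> b (inv\<^bsub>G\<^esub> y \<otimes>\<^bsub>G\<^esub> z) \<otimes>\<^bsub>R\<^esub> c (inv\<^bsub>G\<^esub> z \<otimes>\<^bsub>G\<^esub> x))"
        by (simp add: R.finsum_ldistr fin cl)
    qed (use cl in \<open>auto intro!: R.finsum_closed\<close>)
    also have "\<dots> = (\<Oplus>\<^bsub>R\<^esub>y \<in> A. \<Oplus>\<^bsub>R\<^esub>z \<in> P. a y \<otimes>\<^bsub>R\<^esub> b (inv\<^bsub>G\<^esub> y \<otimes>\<^bsub>G\<^esub> z) \<otimes>\<^bsub>R\<^esub> c (inv\<^bsub>G\<^esub> z \<otimes>\<^bsub>G\<^esub> x))"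
      by (rule finsum_swap) (use fin cl in auto)
    also have "\<dots> = (\<Oplus>\<^bsub>R\<^esub>y \<in> A. a y \<otimes>\<^bsub>R\<^esub> (b \<otimes>\<^bsub>RG\<^esub> c) (inv\<^bsub>G\<^esub> y \<otimes>\<^bsub>G\<^esub> x))"
    proof (rule R.finsum_cong', simp)
      fix y assume y: "y \<in> A"
      then have yG: "y \<in> carrier G" using sub by auto
      let ?t = "\<lambda>z. a y \<otimes>\<^bsub>R\<^esub> b (inv\<^bsub>G\<^esub> y \<otimes>\<^bsub>G\<^esub> z) \<otimes>\<^bsub>R\<^esub> c (inv\<^bsub>G\<^esub> z \<otimes>\<^bsub>G\<^esub> x)"
      have inj: "inj_on (\<lambda>w. y \<otimes>\<^bsub>G\<^esub> w) B"
        using yG sub(2) by (auto simp: inj_on_def subset_iff)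
      have "(\<Oplus>\<^bsub>R\<^esub>z \<in> P. ?t z) = (\<Oplus>\<^bsub>R\<^esub>z \<in> (\<lambda>w. y \<otimes>\<^bsub>G\<^esub> w) ` B. ?t z)"
      proof (rule R.add.finprod_mono_neutral_cong_right)
        show "(\<lambda>w. y \<otimes>\<^bsub>G\<^esub> w) ` B \<subseteq> P"
          using y by (auto simp: P_def A_def B_def set_mult_def)
        fix z assume z: "z \<in> P - (\<lambda>w. y \<otimes>\<^bsub>G\<^esub> w) ` B"
        have "inv\<^bsub>G\<^esub> y \<otimes>\<^bsub>G\<^esub> z \<notin> B"
        proof
          assume "inv\<^bsub>G\<^esub> y \<otimes>\<^bsub>G\<^esub> z \<in> B"
          moreover have "y \<otimes>\<^bsub>G\<^esub> (inv\<^bsub>G\<^esub> y \<otimes>\<^bsub>G\<^esub> z) = z"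
            using z sub yG by (auto simp flip: G.m_assoc)
          ultimately show False using z by force
        qed
        then have "b (inv\<^bsub>G\<^esub> y \<otimes>\<^bsub>G\<^esub> z) = \<zero>\<^bsub>R\<^esub>"
          using RG_zero[OF b] by (auto simp: B_def)
        then show "?t z = \<zero>\<^bsub>R\<^esub>"
          using cl by simp
      qed (use fin cl in auto)
      also have "\<dots> = (\<Oplus>\<^bsub>R\<^esub>w \<in> B. ?t (y \<otimes>\<^bsub>G\<^esub> w))"
        by (rule R.finsum_reindex) (use inj cl in auto)
      also have "\<dots> = (\<Oplus>\<^bsub>R\<^esub>w \<in> B. a y \<otimes>\<^bsub>R\<^esub> (b w \<otimes>\<^bsub>R\<^esub> c (inv\<^bsub>G\<^esub> w \<otimes>\<^bsub>G\<^esub> (inv\<^bsub>G\<^esub> y \<otimes>\<^bsub>G\<^esub> x))))"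
      proof (rule R.finsum_cong', simp)
        fix w assume "w \<in> B"
        then have w: "w \<in> carrier G" using sub by auto
        have "inv\<^bsub>G\<^esub> y \<otimes>\<^bsub>G\<^esub> (y \<otimes>\<^bsub>G\<^esub> w) = w"
          using yG w by (simp flip: G.m_assoc)
        moreover have "inv\<^bsub>G\<^esub> (y \<otimes>\<^bsub>G\<^esub> w) \<otimes>\<^bsub>G\<^esub> x = inv\<^bsub>G\<^esub> w \<otimes>\<^bsub>G\<^esub> (inv\<^bsub>G\<^esub> y \<otimes>\<^bsub>G\<^esub> x)"
          using yG w x by (simp add: G.inv_mult_group G.m_assoc)
        ultimately show "?t (y \<otimes>\<^bsub>G\<^esub> w) =
            a y \<otimes>\<^bsub>R\<^esub> (b w \<otimes>\<^bsub>R\<^esub> c (inv\<^bsub>G\<^esub> w \<otimes>\<^bsub>G\<^esub> (inv\<^bsub>G\<^esub> y \<otimes>\<^bsub>G\<^esub> x)))"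
          using cl by (simp add: R.m_assoc)
      qed (use cl in auto)
      also have "\<dots> = a y \<otimes>\<^bsub>R\<^esub> (\<Oplus>\<^bsub>R\<^esub>w \<in> B. b w \<otimes>\<^bsub>R\<^esub> c (inv\<^bsub>G\<^esub> w \<otimes>\<^bsub>G\<^esub> (inv\<^bsub>G\<^esub> y \<otimes>\<^bsub>G\<^esub> x)))"
        by (rule R.finsum_rdistr[symmetric]) (use fin cl in auto)
      also have "(\<Oplus>\<^bsub>R\<^esub>w \<in> B. b w \<otimes>\<^bsub>R\<^esub> c (inv\<^bsub>G\<^esub> w \<otimes>\<^bsub>G\<^esub> (inv\<^bsub>G\<^esub> y \<otimes>\<^bsub>G\<^esub> x)))
          = (b \<otimes>\<^bsub>RG\<^esub> c) (inv\<^bsub>G\<^esub> y \<otimes>\<^bsub>G\<^esub> x)"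
        using mult_eq[OF b c fin(2) sub(2)] x yG by (simp add: B_def)
      finally show "(\<Oplus>\<^bsub>R\<^esub>z \<in> P. ?t z) = a y \<otimes>\<^bsub>R\<^esub> (b \<otimes>\<^bsub>RG\<^esub> c) (inv\<^bsub>G\<^esub> y \<otimes>\<^bsub>G\<^esub> x)" .
    qed (use cl RG_closed[OF mult_closed[OF b c]] in auto)
    also have "\<dots> = (a \<otimes>\<^bsub>RG\<^esub> (b \<otimes>\<^bsub>RG\<^esub> c)) x"
      using mult_eq[OF a mult_closed[OF b c] fin(1) sub(1) _ x] by (simp add: A_def)
    finally show ?thesis .
  qed (simp add: mult_out)
qed

lemma elt_closed: "g \<in> carrier G \<Longrightarrow> group_elt R g \<in> carrier RG"
  by (rule RG_I[where A = "{g}"]) (auto simp: group_elt_def)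

lemma elt_mult:
  assumes g: "g \<in> carrier G" and a: "a \<in> carrier RG" and x: "x \<in> carrier G"
  shows "(group_elt R g \<otimes>\<^bsub>RG\<^esub> a) x = a (inv\<^bsub>G\<^esub> g \<otimes>\<^bsub>G\<^esub> x)"
proof -
  have "supp (group_elt R g) \<subseteq> {g}" by (auto simp: group_elt_def)
  moreover have "group_elt R g g = \<one>\<^bsub>R\<^esub>" by (simp add: group_elt_def)
  ultimately show ?thesis
    using mult_eq[OF elt_closed[OF g] a, of "{g}" x] g x RG_closed[OF a] by simp
qed

lemma mult_elt:
  assumes g: "g \<in> carrier G" and a: "a \<in> carrier RG" and x: "x \<in> carrier G"
  shows "(a \<otimes>\<^bsub>RG\<^esub> group_elt R g) x = a (x \<otimes>\<^bsub>G\<^esub> inv\<^bsub>G\<^esub> g)"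
proof -
  let ?w = "x \<otimes>\<^bsub>G\<^esub> inv\<^bsub>G\<^esub> g"
  have w: "?w \<in> carrier G" using g x by simp
  have iff: "inv\<^bsub>G\<^esub> y \<otimes>\<^bsub>G\<^esub> x = g \<longleftrightarrow> y = ?w" if "y \<in> carrier G" for y
    using that g x by (metis G.inv_closed G.inv_inv G.inv_solve_left G.inv_solve_right)
  have elt: "group_elt R g y \<in> carrier R" for y by (simp add: group_elt_def)
  have "(a \<otimes>\<^bsub>RG\<^esub> group_elt R g) x
      = (\<Oplus>\<^bsub>R\<^esub>y \<in> insert ?w (supp a). a y \<otimes>\<^bsub>R\<^esub> group_elt R g (inv\<^bsub>G\<^esub> y \<otimes>\<^bsub>G\<^esub> x))"
    by (rule mult_eq) (use a x w RG_finite[OF a] elt_closed[OF g] in auto)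
  also have "\<dots> = (\<Oplus>\<^bsub>R\<^esub>y \<in> {?w}. a y \<otimes>\<^bsub>R\<^esub> group_elt R g (inv\<^bsub>G\<^esub> y \<otimes>\<^bsub>G\<^esub> x))"
    by (rule R.add.finprod_mono_neutral_cong_right)
      (use w iff RG_finite[OF a] RG_closed[OF a] elt in \<open>auto simp: group_elt_def\<close>)
  also have "\<dots> = a ?w"
    using iff[OF w] RG_closed[OF a] by (auto simp: group_elt_def)
  finally show ?thesis .
qed

lemma one_eq: "\<one>\<^bsub>RG\<^esub> = group_elt R \<one>\<^bsub>G\<^esub>"
  by (simp add: group_ring_def group_elt_def)

lemma add_eq: "(a \<oplus>\<^bsub>RG\<^esub> b) x = a x \<oplus>\<^bsub>R\<^esub> b x" and zero_eq: "\<zero>\<^bsub>RG\<^esub> x = \<zero>\<^bsub>R\<^esub>"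
  by (simp_all add: group_ring_def)

lemma add_closed:
  assumes a: "a \<in> carrier RG" and b: "b \<in> carrier RG"
  shows "a \<oplus>\<^bsub>RG\<^esub> b \<in> carrier RG"
  by (rule RG_I[where A = "supp a \<union> supp b"])
    (use RG_finite[OF a] RG_finite[OF b] RG_closed[OF a] RG_closed[OF b] RG_zero[OF a] RG_zero[OF b]
      in \<open>auto simp: add_eq\<close>)

lemma ring_group_ring: "ring RG"
proof (rule ringI)
  show "abelian_group RG"
  proof (rule abelian_groupI)
    show "\<zero>\<^bsub>RG\<^esub> \<in> carrier RG"
      by (rule RG_I[where A = "{}"]) (auto simp: zero_eq)
  next
    fix a assume a: "a \<in> carrier RG"
    have "(\<lambda>x. \<ominus>\<^bsub>R\<^esub> a x) \<in> carrier RG"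
      by (rule RG_I[where A = "supp a"]) (use RG_finite[OF a] RG_closed[OF a] RG_zero[OF a] in auto)
    moreover have "(\<lambda>x. \<ominus>\<^bsub>R\<^esub> a x) \<oplus>\<^bsub>RG\<^esub> a = \<zero>\<^bsub>RG\<^esub>"
      using RG_closed[OF a] by (auto simp: fun_eq_iff add_eq zero_eq R.l_neg)
    ultimately show "\<exists>b \<in> carrier RG. b \<oplus>\<^bsub>RG\<^esub> a = \<zero>\<^bsub>RG\<^esub>" by blast
  next
    fix a b c assume "a \<in> carrier RG" "b \<in> carrier RG" "c \<in> carrier RG"
    from this[THEN RG_closed]
    show "a \<oplus>\<^bsub>RG\<^esub> b \<oplus>\<^bsub>RG\<^esub> c = a \<oplus>\<^bsub>RG\<^esub> (b \<oplus>\<^bsub>RG\<^esub> c)"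
      by (auto simp: fun_eq_iff add_eq R.a_assoc)
  next
    fix a b assume "a \<in> carrier RG" "b \<in> carrier RG"
    from this[THEN RG_closed] show "a \<oplus>\<^bsub>RG\<^esub> b = b \<oplus>\<^bsub>RG\<^esub> a"
      by (auto simp: fun_eq_iff add_eq R.a_comm)
  next
    fix a assume "a \<in> carrier RG"
    from this[THEN RG_closed] show "\<zero>\<^bsub>RG\<^esub> \<oplus>\<^bsub>RG\<^esub> a = a"
      by (auto simp: fun_eq_iff add_eq zero_eq)
  qed (auto simp: add_closed)
next
  show "Group.monoid RG"
  proof (rule monoidI)
    fix a assume a: "a \<in> carrier RG"
    show "\<one>\<^bsub>RG\<^esub> \<otimes>\<^bsub>RG\<^esub> a = a"
    proof
      fix x show "(\<one>\<^bsub>RG\<^esub> \<otimes>\<^bsub>RG\<^esub> a) x = a x"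
        using RG_zero[OF a] by (cases "x \<in> carrier G") (auto simp: one_eq elt_mult[OF _ a] mult_out)
    qed
    show "a \<otimes>\<^bsub>RG\<^esub> \<one>\<^bsub>RG\<^esub> = a"
    proof
      fix x show "(a \<otimes>\<^bsub>RG\<^esub> \<one>\<^bsub>RG\<^esub>) x = a x"
        using RG_zero[OF a] by (cases "x \<in> carrier G") (auto simp: one_eq mult_elt[OF _ a] mult_out)
    qed
  qed (auto simp: mult_closed mult_assoc one_eq elt_closed)
next
  fix a b c assume a: "a \<in> carrier RG" and b: "b \<in> carrier RG" and c: "c \<in> carrier RG"
  note cl = RG_closed[OF a] RG_closed[OF b] RG_closed[OF c]
  show "(a \<oplus>\<^bsub>RG\<^esub> b) \<otimes>\<^bsub>RG\<^esub> c = a \<otimes>\<^bsub>RG\<^esub> c \<oplus>\<^bsub>RG\<^esub> b \<otimes>\<^bsub>RG\<^esub> c"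
  proof
    fix x
    let ?A = "supp a \<union> supp b"
    have A: "finite ?A" "?A \<subseteq> carrier G" using RG_finite a b by auto
    have s: "supp (a \<oplus>\<^bsub>RG\<^esub> b) \<subseteq> ?A" using cl by (auto simp: add_eq)
    show "((a \<oplus>\<^bsub>RG\<^esub> b) \<otimes>\<^bsub>RG\<^esub> c) x = (a \<otimes>\<^bsub>RG\<^esub> c \<oplus>\<^bsub>RG\<^esub> b \<otimes>\<^bsub>RG\<^esub> c) x"
    proof (cases "x \<in> carrier G")
      case True
      show ?thesis
        unfolding add_eq mult_eq[OF add_closed[OF a b] c A s True]
          mult_eq[OF a c A Un_upper1 True] mult_eq[OF b c A Un_upper2 True]
        using cl by (simp add: R.l_distr R.finsum_addf)
    qed (simp add: add_eq mult_out)
  qed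
  show "c \<otimes>\<^bsub>RG\<^esub> (a \<oplus>\<^bsub>RG\<^esub> b) = c \<otimes>\<^bsub>RG\<^esub> a \<oplus>\<^bsub>RG\<^esub> c \<otimes>\<^bsub>RG\<^esub> b"
  proof
    fix x
    have C: "finite (supp c)" "supp c \<subseteq> carrier G" using RG_finite c by auto
    show "(c \<otimes>\<^bsub>RG\<^esub> (a \<oplus>\<^bsub>RG\<^esub> b)) x = (c \<otimes>\<^bsub>RG\<^esub> a \<oplus>\<^bsub>RG\<^esub> c \<otimes>\<^bsub>RG\<^esub> b) x"
    proof (cases "x \<in> carrier G")
      case True
      show ?thesis
        unfolding add_eq mult_eq[OF c add_closed[OF a b] C subset_refl True]
          mult_eq[OF c a C subset_refl True] mult_eq[OF c b C subset_refl True]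
        using cl by (simp add: R.r_distr R.finsum_addf)
    qed (simp add: add_eq mult_out)
  qed
qed

lemma elt_mult_elt:
  assumes g: "g \<in> carrier G" and h: "h \<in> carrier G"
  shows "group_elt R g \<otimes>\<^bsub>RG\<^esub> group_elt R h = group_elt R (g \<otimes>\<^bsub>G\<^esub> h)"
proof
  fix x
  have "inv\<^bsub>G\<^esub> g \<otimes>\<^bsub>G\<^esub> x = h \<longleftrightarrow> x = g \<otimes>\<^bsub>G\<^esub> h" if "x \<in> carrier G"
    using that g h by (metis G.inv_closed G.inv_inv G.inv_solve_left)
  then have "group_elt R h (inv\<^bsub>G\<^esub> g \<otimes>\<^bsub>G\<^esub> x) = group_elt R (g \<otimes>\<^bsub>G\<^esub> h) x" if "x \<in> carrier G"
    using that by (simp add: group_elt_def)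
  moreover have "group_elt R (g \<otimes>\<^bsub>G\<^esub> h) x = \<zero>\<^bsub>R\<^esub>" if "x \<notin> carrier G"
    using that g h by (auto simp: group_elt_def)
  ultimately show "(group_elt R g \<otimes>\<^bsub>RG\<^esub> group_elt R h) x = group_elt R (g \<otimes>\<^bsub>G\<^esub> h) x"
    using elt_mult[OF g elt_closed[OF h]] mult_out by (cases "x \<in> carrier G") simp_all
qed

lemma group_elt_mon:
  assumes "\<one>\<^bsub>R\<^esub> \<noteq> \<zero>\<^bsub>R\<^esub>"
  shows "group_elt R \<in> mon G (units_of RG)"
proof -
  have "group_elt R g \<in> Units RG" if "g \<in> carrier G" for g
    unfolding Units_def using that elt_mult_elt[of g "inv\<^bsub>G\<^esub> g"] elt_mult_elt[of "inv\<^bsub>G\<^esub> g" g]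
    by (auto simp: one_eq elt_closed intro!: bexI[of _ "group_elt R (inv\<^bsub>G\<^esub> g)"])
  moreover have "inj_on (group_elt R) (carrier G)"
    using assms by (auto simp: inj_on_def group_elt_def fun_eq_iff split: if_splits)
  ultimately show ?thesis
    by (auto simp: mon_def hom_def units_of_def elt_mult_elt)
qed

end

end

theory Submission
  imports Defs "HOL-Number_Theory.Cong" "HOL-Computational_Algebra.Group_Closure"
begin

text \<open>
  Let \<open>u\<close> be a unit of $RG$ that normalizes \<open>H\<close>. Conjugation by \<open>u\<close> is an injective homomorphism \<open>\<phi>\<close> from
  \<open>H\<close> into \<open>G\<close>. Summing coefficients over a conjugacy class of \<open>G\<close> is a trace on $RG$, so group elements
  that are conjugate by a unit are already conjugate in \<open>G\<close> (\<open>conjugate_in_units_imp_conjugate\<close>). Thus \<open>\<phi>\<close> sends each \<open>h\<close>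
  to a conjugate of \<open>h\<close>, by an element of \<open>G\<close> that may depend on \<open>h\<close>. The claim follows if one
  element of \<open>G\<close> can be found that works for all \<open>h\<close> (\<open>normalizer_eq_normalizer_centralizer\<close>), and from here on the group
  ring has disappeared: for the metacyclic groups in question, every such pointwise inner homomorphism is inner.

  Let \<open>A\<close> be the cyclic kernel. Then \<open>H\<close> is generated by a generator \<open>a\<close> of $H \cap A$ and one more element \<open>b\<close>. Up to an
  inner automorphism of \<open>G\<close>, \<open>\<phi>\<close> fixes \<open>b\<close>, and it acts on \<open>a\<close> as some element of \<open>G\<close> does. As
  \<open>A\<close> centralizes \<open>a\<close>, only the coset of that element modulo \<open>A\<close> matters. So \<open>\<phi>\<close> is inner as soon as \<open>b\<close> commutes
  with some \<open>s\<close> whose coset generates $G/A$ (\<open>pointwise_inner_two_generators\<close>). The three hypotheses provide such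
  an \<open>s\<close>, except in situations where \<open>H\<close> is cyclic and there is nothing to combine. If $G/A$ has
  prime order, then \<open>s = b\<close> works. If \<open>A\<close> has prime order and lies in \<open>H\<close>, then \<open>b\<close> can be taken as a power of a lift \<open>s\<close> of
  the generator of $G/A$. If the orders are coprime, then \<open>b\<close> can be chosen of order prime to that of \<open>A\<close>,
  and a linear congruence yields a lift commuting with it (\<open>ex_commuting_in_coset\<close>).
\<close>

section \<open>Conjugation\<close>

lemma (in group) conj_hom:
  "x \<in> carrier G \<Longrightarrow> (\<lambda>h. x \<otimes> h \<otimes> inv x) \<in> hom G G"
proof (rule homI)
  fix g h assume gh: "x \<in> carrier G" "g \<in> carrier G" "h \<in> carrier G"
  then have "inv x \<otimes> (x \<otimes> (h \<otimes> inv x)) = h \<otimes> inv x" by (simp flip: m_assoc)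
  with gh show "x \<otimes> (g \<otimes> h) \<otimes> inv x = x \<otimes> g \<otimes> inv x \<otimes> (x \<otimes> h \<otimes> inv x)"
    by (simp add: m_assoc)
qed simp

lemma (in group) conj_int_pow:
  "x \<in> carrier G \<Longrightarrow> h \<in> carrier G \<Longrightarrow> (x \<otimes> h \<otimes> inv x) [^] (i::int) = x \<otimes> h [^] i \<otimes> inv x"
  using hom_int_pow[OF conj_hom] by (simp add: is_group)

lemma (in group) conj_mult:
  "x \<in> carrier G \<Longrightarrow> y \<in> carrier G \<Longrightarrow> h \<in> carrier G \<Longrightarrow>
    (x \<otimes> y) \<otimes> h \<otimes> inv (x \<otimes> y) = x \<otimes> (y \<otimes> h \<otimes> inv y) \<otimes> inv x"
  by (simp add: m_assoc inv_mult_group)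

lemma (in group) conj_fixed_iff:
  "x \<in> carrier G \<Longrightarrow> h \<in> carrier G \<Longrightarrow> x \<otimes> h \<otimes> inv x = h \<longleftrightarrow> x \<otimes> h = h \<otimes> x"
  by (metis inv_solve_right m_closed)

lemma (in group) int_pow_commute:
  assumes "x \<otimes> y = y \<otimes> x" "x \<in> carrier G" "y \<in> carrier G"
  shows "x [^] (k::int) \<otimes> y = y \<otimes> x [^] k"
proof -
  have "y \<otimes> x \<otimes> inv y = x" using assms conj_fixed_iff by metis
  then have "y \<otimes> x [^] k \<otimes> inv y = x [^] k" using conj_int_pow assms by metis
  then show ?thesis using assms conj_fixed_iff by (metis int_pow_closed)
qed

lemma (in group) hom_subgroup_int_pow:
  assumes "subgroup H G" "\<phi> \<in> hom (G\<lparr>carrier := H\<rparr>) G" "h \<in> H"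
  shows "\<phi> (h [^] (i::int)) = \<phi> h [^] i"
  using hom_int_pow[OF assms(2), of h i] subgroup_imp_group[OF assms(1)] assms
  by (simp add: is_group int_pow_consistent)

section \<open>Conjugacy traces on the group ring\<close>

context group_ring_setup
begin

text \<open>On the full group ring this is the $R$-linear functional \<open>a \<mapsto> \<Sum>x \<in> C. a x\<close>; the sum is cut down to the
  support because \<open>C\<close> may be infinite. It behaves like a trace when \<open>C\<close> is a conjugacy class.\<close>

definition class_trace :: "'g set \<Rightarrow> ('g \<Rightarrow> 'r) \<Rightarrow> 'r"
  where "class_trace C a = (\<Oplus>\<^bsub>R\<^esub>x \<in> supp a \<inter> C. a x)"

lemma class_trace_eq:
  assumes a: "a \<in> carrier RG" and A: "finite A" "A \<subseteq> carrier G" "supp a \<subseteq> A"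
  shows "class_trace C a = (\<Oplus>\<^bsub>R\<^esub>x \<in> A. if x \<in> C then a x else \<zero>\<^bsub>R\<^esub>)"
  unfolding class_trace_def
  by (rule R.add.finprod_mono_neutral_cong_left) (use A RG_closed[OF a] in auto)

lemma class_trace_elt:
  assumes "g \<in> carrier G"
  shows "class_trace C (group_elt R g) = (if g \<in> C then \<one>\<^bsub>R\<^esub> else \<zero>\<^bsub>R\<^esub>)"
proof -
  have "class_trace C (group_elt R g) =
      (\<Oplus>\<^bsub>R\<^esub>x \<in> {g}. if x \<in> C then group_elt R g x else \<zero>\<^bsub>R\<^esub>)"
    by (rule class_trace_eq[OF elt_closed]) (use assms in \<open>auto simp: group_elt_def\<close>)
  then show ?thesis by (simp add: group_elt_def)
qed

text \<open>This form is visibly bilinear in \<open>a\<close> and \<open>b\<close> and runs over pairs of support elements, so that the two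
  factors enter symmetrically except for the order of the product \<open>y \<otimes> z\<close>. It comes from the
  substitution \<open>x = y \<otimes> z\<close> in the convolution.\<close>

lemma class_trace_mult:
  assumes a: "a \<in> carrier RG" and b: "b \<in> carrier RG"
  shows "class_trace C (a \<otimes>\<^bsub>RG\<^esub> b) =
    (\<Oplus>\<^bsub>R\<^esub>y \<in> supp a. \<Oplus>\<^bsub>R\<^esub>z \<in> supp b. if y \<otimes>\<^bsub>G\<^esub> z \<in> C then a y \<otimes>\<^bsub>R\<^esub> b z else \<zero>\<^bsub>R\<^esub>)"
proof -
  define A B P where "A = supp a" and "B = supp b" and "P = supp a <#>\<^bsub>G\<^esub> supp b"
  have fin: "finite A" "finite B" "finite P" and sub: "A \<subseteq> carrier G" "B \<subseteq> carrier G" "P \<subseteq> carrier G"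
    using RG_finite[OF a] RG_finite[OF b] supp_prod[OF a b] by (auto simp: A_def B_def P_def)
  have suppP: "supp (a \<otimes>\<^bsub>RG\<^esub> b) \<subseteq> P"
    using mult_supp[OF a b] by (auto simp: P_def)
  note cl = RG_closed[OF a] RG_closed[OF b]
  let ?t = "\<lambda>x y. if x \<in> C then a y \<otimes>\<^bsub>R\<^esub> b (inv\<^bsub>G\<^esub> y \<otimes>\<^bsub>G\<^esub> x) else \<zero>\<^bsub>R\<^esub>"
  have "class_trace C (a \<otimes>\<^bsub>RG\<^esub> b) = (\<Oplus>\<^bsub>R\<^esub>x \<in> P. if x \<in> C then (a \<otimes>\<^bsub>RG\<^esub> b) x else \<zero>\<^bsub>R\<^esub>)"
    by (rule class_trace_eq[OF mult_closed[OF a b] fin(3) sub(3) suppP])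
  also have "\<dots> = (\<Oplus>\<^bsub>R\<^esub>x \<in> P. \<Oplus>\<^bsub>R\<^esub>y \<in> A. ?t x y)"
  proof (rule R.finsum_cong', simp)
    fix x assume "x \<in> P"
    then show "(if x \<in> C then (a \<otimes>\<^bsub>RG\<^esub> b) x else \<zero>\<^bsub>R\<^esub>) = (\<Oplus>\<^bsub>R\<^esub>y \<in> A. ?t x y)"
      using mult_eq[OF a b fin(1) sub(1)] sub by (auto simp: A_def)
  qed (use cl in \<open>auto intro!: R.finsum_closed\<close>)
  also have "\<dots> = (\<Oplus>\<^bsub>R\<^esub>y \<in> A. \<Oplus>\<^bsub>R\<^esub>x \<in> P. ?t x y)"
    by (rule finsum_swap) (use fin cl in auto)
  also have "\<dots> = (\<Oplus>\<^bsub>R\<^esub>y \<in> A. \<Oplus>\<^bsub>R\<^esub>z \<in> B. if y \<otimes>\<^bsub>G\<^esub> z \<in> C then a y \<otimes>\<^bsub>R\<^esub> b z else \<zero>\<^bsub>R\<^esub>)"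
  proof (rule R.finsum_cong', simp)
    fix y assume y: "y \<in> A"
    then have yG: "y \<in> carrier G" using sub by auto
    have cancel: "inv\<^bsub>G\<^esub> y \<otimes>\<^bsub>G\<^esub> (y \<otimes>\<^bsub>G\<^esub> w) = w" "y \<otimes>\<^bsub>G\<^esub> (inv\<^bsub>G\<^esub> y \<otimes>\<^bsub>G\<^esub> w) = w"
      if "w \<in> carrier G" for w
      using yG that by (simp_all flip: G.m_assoc)
    have inj: "inj_on (\<lambda>w. y \<otimes>\<^bsub>G\<^esub> w) B"
      using yG sub(2) by (auto simp: inj_on_def subset_iff)
    have "(\<Oplus>\<^bsub>R\<^esub>x \<in> P. ?t x y) = (\<Oplus>\<^bsub>R\<^esub>x \<in> (\<lambda>w. y \<otimes>\<^bsub>G\<^esub> w) ` B. ?t x y)"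
    proof (rule R.add.finprod_mono_neutral_cong_right)
      show "(\<lambda>w. y \<otimes>\<^bsub>G\<^esub> w) ` B \<subseteq> P"
        using y by (auto simp: P_def A_def B_def set_mult_def)
      fix x assume x: "x \<in> P - (\<lambda>w. y \<otimes>\<^bsub>G\<^esub> w) ` B"
      then have xG: "x \<in> carrier G" using sub by auto
      have "inv\<^bsub>G\<^esub> y \<otimes>\<^bsub>G\<^esub> x \<notin> B"
      proof
        assume "inv\<^bsub>G\<^esub> y \<otimes>\<^bsub>G\<^esub> x \<in> B"
        then show False using x cancel(2)[OF xG] by force
      qed
      then have "b (inv\<^bsub>G\<^esub> y \<otimes>\<^bsub>G\<^esub> x) = \<zero>\<^bsub>R\<^esub>"
        using RG_zero[OF b] by (auto simp: B_def)
      then show "?t x y = \<zero>\<^bsub>R\<^esub>"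
        using cl by simp
    qed (use fin cl in auto)
    also have "\<dots> = (\<Oplus>\<^bsub>R\<^esub>z \<in> B. ?t (y \<otimes>\<^bsub>G\<^esub> z) y)"
      by (rule R.finsum_reindex) (use inj cl in auto)
    also have "\<dots> = (\<Oplus>\<^bsub>R\<^esub>z \<in> B. if y \<otimes>\<^bsub>G\<^esub> z \<in> C then a y \<otimes>\<^bsub>R\<^esub> b z else \<zero>\<^bsub>R\<^esub>)"
      by (rule R.finsum_cong') (use cancel(1) cl sub(2) in \<open>auto simp: subset_iff\<close>)
    finally show "(\<Oplus>\<^bsub>R\<^esub>x \<in> P. ?t x y) =
        (\<Oplus>\<^bsub>R\<^esub>z \<in> B. if y \<otimes>\<^bsub>G\<^esub> z \<in> C then a y \<otimes>\<^bsub>R\<^esub> b z else \<zero>\<^bsub>R\<^esub>)" .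
  qed (use cl in \<open>auto intro!: R.finsum_closed\<close>)
  finally show ?thesis by (simp add: A_def B_def)
qed

text \<open>The condition on \<open>C\<close> says that it is closed under conjugation, since \<open>z \<otimes> y\<close> is conjugate to
  \<open>y \<otimes> z\<close>. Commutativity of \<open>R\<close> is essential for the exchange of the coefficients.\<close>

lemma class_trace_commute:
  assumes a: "a \<in> carrier RG" and b: "b \<in> carrier RG"
    and C: "\<And>y z. y \<in> carrier G \<Longrightarrow> z \<in> carrier G \<Longrightarrow> y \<otimes>\<^bsub>G\<^esub> z \<in> C \<longleftrightarrow> z \<otimes>\<^bsub>G\<^esub> y \<in> C"
  shows "class_trace C (a \<otimes>\<^bsub>RG\<^esub> b) = class_trace C (b \<otimes>\<^bsub>RG\<^esub> a)"
proof -
  note cl = RG_closed[OF a] RG_closed[OF b]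
  have "class_trace C (a \<otimes>\<^bsub>RG\<^esub> b) =
      (\<Oplus>\<^bsub>R\<^esub>z \<in> supp b. \<Oplus>\<^bsub>R\<^esub>y \<in> supp a. if y \<otimes>\<^bsub>G\<^esub> z \<in> C then a y \<otimes>\<^bsub>R\<^esub> b z else \<zero>\<^bsub>R\<^esub>)"
    unfolding class_trace_mult[OF a b]
    by (rule finsum_swap) (use RG_finite[OF a] RG_finite[OF b] cl in auto)
  also have "\<dots> =
      (\<Oplus>\<^bsub>R\<^esub>z \<in> supp b. \<Oplus>\<^bsub>R\<^esub>y \<in> supp a. if z \<otimes>\<^bsub>G\<^esub> y \<in> C then b z \<otimes>\<^bsub>R\<^esub> a y else \<zero>\<^bsub>R\<^esub>)"
    by (intro R.finsum_cong' refl) (use C cl in \<open>auto intro!: R.finsum_closed R.m_comm\<close>)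
  also have "\<dots> = class_trace C (b \<otimes>\<^bsub>RG\<^esub> a)"
    by (rule class_trace_mult[OF b a, symmetric])
  finally show ?thesis .
qed

text \<open>Elements of \<open>G\<close> that are conjugate by a unit have the same trace on every conjugacy class of \<open>G\<close>. The
  trace of a group element on a class is \<open>1\<close> or \<open>0\<close> according to whether it lies in the class, so \<open>R \<noteq> 0\<close> lets
  the traces tell the classes apart.\<close>

lemma conjugate_in_units_imp_conjugate:
  assumes nz: "\<one>\<^bsub>R\<^esub> \<noteq> \<zero>\<^bsub>R\<^esub>" and u: "u \<in> Units RG" and h: "h \<in> carrier G" and k: "k \<in> carrier G"
    and uh: "u \<otimes>\<^bsub>RG\<^esub> group_elt R h = group_elt R k \<otimes>\<^bsub>RG\<^esub> u"
  shows "\<exists>g \<in> carrier G. k = g \<otimes>\<^bsub>G\<^esub> h \<otimes>\<^bsub>G\<^esub> inv\<^bsub>G\<^esub> g"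
proof -
  interpret RG: ring RG by (rule ring_group_ring)
  define C where "C = {g \<otimes>\<^bsub>G\<^esub> h \<otimes>\<^bsub>G\<^esub> inv\<^bsub>G\<^esub> g | g. g \<in> carrier G}"
  have C_imp: "z \<otimes>\<^bsub>G\<^esub> y \<in> C" if yz: "y \<in> carrier G" "z \<in> carrier G" "y \<otimes>\<^bsub>G\<^esub> z \<in> C" for y z
  proof -
    obtain g where g: "g \<in> carrier G" "y \<otimes>\<^bsub>G\<^esub> z = g \<otimes>\<^bsub>G\<^esub> h \<otimes>\<^bsub>G\<^esub> inv\<^bsub>G\<^esub> g"
      using yz(3) by (auto simp: C_def)
    \<comment> \<open>the product in the other order is the conjugate by \<open>z\<close>\<close>
    have "z \<otimes>\<^bsub>G\<^esub> y = z \<otimes>\<^bsub>G\<^esub> (y \<otimes>\<^bsub>G\<^esub> z) \<otimes>\<^bsub>G\<^esub> inv\<^bsub>G\<^esub> z"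
      using yz by (simp add: G.m_assoc)
    also have "\<dots> = (z \<otimes>\<^bsub>G\<^esub> g) \<otimes>\<^bsub>G\<^esub> h \<otimes>\<^bsub>G\<^esub> inv\<^bsub>G\<^esub> (z \<otimes>\<^bsub>G\<^esub> g)"
      using yz g h by (simp add: G.conj_mult)
    finally show ?thesis unfolding C_def using yz(2) g(1) by blast
  qed
  let ?v = "inv\<^bsub>RG\<^esub> u"
  have cl: "u \<in> carrier RG" "?v \<in> carrier RG" "group_elt R h \<in> carrier RG" "group_elt R k \<in> carrier RG"
    using u h k by (auto intro: elt_closed)
  have ek: "group_elt R k = (u \<otimes>\<^bsub>RG\<^esub> group_elt R h) \<otimes>\<^bsub>RG\<^esub> ?v"
    unfolding uh using u cl by (simp add: RG.m_assoc RG.Units_r_inv)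
  have eh: "group_elt R h = ?v \<otimes>\<^bsub>RG\<^esub> (u \<otimes>\<^bsub>RG\<^esub> group_elt R h)"
    using u cl by (simp add: RG.Units_l_inv flip: RG.m_assoc)
  have "class_trace C (group_elt R k) = class_trace C (group_elt R h)"
  proof -
    have "class_trace C (group_elt R k) = class_trace C (?v \<otimes>\<^bsub>RG\<^esub> (u \<otimes>\<^bsub>RG\<^esub> group_elt R h))"
      unfolding ek using mult_closed[OF cl(1,3)] cl(2)
      by (rule class_trace_commute) (blast intro: C_imp)
    then show ?thesis by (simp only: eh[symmetric])
  qed
  moreover have "h \<in> C" unfolding C_def using h by (auto intro!: exI[of _ "\<one>\<^bsub>G\<^esub>"])
  ultimately have "k \<in> C" using h k nz by (auto simp: class_trace_elt split: if_splits)
  then show ?thesis by (auto simp: C_def)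
qed

end

section \<open>Normalizers and pointwise inner homomorphisms\<close>

definition (in group) pointwise_inner :: "('a \<Rightarrow> 'a) \<Rightarrow> 'a set \<Rightarrow> bool"
  where "pointwise_inner \<phi> H \<longleftrightarrow>
    \<phi> \<in> hom (G\<lparr>carrier := H\<rparr>) G \<and> (\<forall>h \<in> H. \<exists>g \<in> carrier G. \<phi> h = g \<otimes> h \<otimes> inv g)"

definition (in group) inner_on :: "('a \<Rightarrow> 'a) \<Rightarrow> 'a set \<Rightarrow> bool"
  where "inner_on \<phi> H \<longleftrightarrow> (\<exists>g \<in> carrier G. \<forall>h \<in> H. \<phi> h = g \<otimes> h \<otimes> inv g)"

lemma (in group) normalizer_iff_conj_image:
  assumes "H \<subseteq> carrier G"
  shows "x \<in> normalizer G H \<longleftrightarrow> x \<in> carrier G \<and> (\<lambda>h. x \<otimes> h \<otimes> inv x) ` H = H"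
proof -
  have "x <# H #> inv x = (\<lambda>h. x \<otimes> h \<otimes> inv x) ` H"
    by (auto simp: l_coset_def r_coset_def)
  then show ?thesis using assms by (simp add: normalizer_def stabilizer_def)
qed

text \<open>A normalizing element \<open>u\<close> of \<open>U\<close> induces on \<open>H\<close> a homomorphism into \<open>G\<close> that is pointwise inner by
  the hypothesis on conjugacy. If it is conjugation by some \<open>g\<close> of \<open>G\<close>, then \<open>u\<close> and \<open>g\<close> act alike on \<open>H\<close>, which means that
  \<open>g\<close> normalizes \<open>H\<close> and \<open>inv g \<otimes> u\<close> centralizes it.\<close>

lemma (in group) normalizer_eq_normalizer_centralizer:
  fixes U :: "('u, 'c) monoid_scheme"
  assumes U: "group U" and \<epsilon>: "\<epsilon> \<in> mon G U" and H: "subgroup H G"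
    and conj: "\<And>u h k. u \<in> carrier U \<Longrightarrow> h \<in> carrier G \<Longrightarrow> k \<in> carrier G \<Longrightarrow>
      u \<otimes>\<^bsub>U\<^esub> \<epsilon> h = \<epsilon> k \<otimes>\<^bsub>U\<^esub> u \<Longrightarrow> \<exists>g \<in> carrier G. k = g \<otimes> h \<otimes> inv g"
    and inner: "\<And>\<phi>. pointwise_inner \<phi> H \<Longrightarrow> inner_on \<phi> H"
  shows "normalizer U (\<epsilon> ` H) = (\<epsilon> ` normalizer G H) <#>\<^bsub>U\<^esub> centralizer U (\<epsilon> ` H)"
proof -
  interpret U: group U by (rule U)
  interpret \<epsilon>: group_hom G U \<epsilon>
    using \<epsilon> by (auto simp: mon_def intro!: group_hom.intro group_hom_axioms.intro)
  have inj: "inj_on \<epsilon> (carrier G)" using \<epsilon> by (simp add: mon_def)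
  note HG = subgroup.mem_carrier[OF H]
  have Hsub: "H \<subseteq> carrier G" and \<epsilon>H: "\<epsilon> ` H \<subseteq> carrier U" using HG by auto
  note N_G = normalizer_iff_conj_image[OF Hsub] and N_U = U.normalizer_iff_conj_image[OF \<epsilon>H]
  show ?thesis
  proof (intro equalityI subsetI)
    fix w assume "w \<in> (\<epsilon> ` normalizer G H) <#>\<^bsub>U\<^esub> centralizer U (\<epsilon> ` H)"
    then obtain g c where g: "g \<in> normalizer G H" and c: "c \<in> centralizer U (\<epsilon> ` H)"
      and w: "w = \<epsilon> g \<otimes>\<^bsub>U\<^esub> c" unfolding set_mult_def by blast
    have gG: "g \<in> carrier G" and gH: "(\<lambda>h. g \<otimes> h \<otimes> inv g) ` H = H" using g by (auto simp: N_G)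
    have cU: "c \<in> carrier U" using c by (simp add: centralizer_def)
    have "w \<otimes>\<^bsub>U\<^esub> \<epsilon> h \<otimes>\<^bsub>U\<^esub> inv\<^bsub>U\<^esub> w = \<epsilon> (g \<otimes> h \<otimes> inv g)" if h: "h \<in> H" for h
    proof -
      have "c \<otimes>\<^bsub>U\<^esub> \<epsilon> h \<otimes>\<^bsub>U\<^esub> inv\<^bsub>U\<^esub> c = \<epsilon> h"
        using c h HG cU U.conj_fixed_iff[of c "\<epsilon> h"] by (simp add: centralizer_def)
      then show ?thesis using U.conj_mult[of "\<epsilon> g" c "\<epsilon> h"] gG cU h HG by (simp add: w)
    qed
    then have "(\<lambda>x. w \<otimes>\<^bsub>U\<^esub> x \<otimes>\<^bsub>U\<^esub> inv\<^bsub>U\<^esub> w) ` \<epsilon> ` H = \<epsilon> ` (\<lambda>h. g \<otimes> h \<otimes> inv g) ` H"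
      unfolding image_image by (rule image_cong[OF refl])
    then show "w \<in> normalizer U (\<epsilon> ` H)" using gH gG cU by (simp add: N_U w)
  next
    fix u assume "u \<in> normalizer U (\<epsilon> ` H)"
    then have u: "u \<in> carrier U" and uH: "(\<lambda>x. u \<otimes>\<^bsub>U\<^esub> x \<otimes>\<^bsub>U\<^esub> inv\<^bsub>U\<^esub> u) ` \<epsilon> ` H = \<epsilon> ` H"
      by (auto simp: N_U)
    \<comment> \<open>conjugation by \<open>u\<close>, read back in \<open>G\<close> along the embedding\<close>
    define \<phi> where "\<phi> h = inv_into H \<epsilon> (u \<otimes>\<^bsub>U\<^esub> \<epsilon> h \<otimes>\<^bsub>U\<^esub> inv\<^bsub>U\<^esub> u)" for h
    have mem: "u \<otimes>\<^bsub>U\<^esub> \<epsilon> h \<otimes>\<^bsub>U\<^esub> inv\<^bsub>U\<^esub> u \<in> \<epsilon> ` H" if "h \<in> H" for h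
      using uH that by blast
    have \<phi>H: "\<phi> h \<in> H" and \<epsilon>\<phi>: "\<epsilon> (\<phi> h) = u \<otimes>\<^bsub>U\<^esub> \<epsilon> h \<otimes>\<^bsub>U\<^esub> inv\<^bsub>U\<^esub> u" if "h \<in> H" for h
      using inv_into_into[OF mem[OF that]] f_inv_into_f[OF mem[OF that]] by (simp_all add: \<phi>_def)
    have "\<phi> \<in> hom (G\<lparr>carrier := H\<rparr>) G"
    proof (rule homI)
      fix h k assume hk: "h \<in> carrier (G\<lparr>carrier := H\<rparr>)" "k \<in> carrier (G\<lparr>carrier := H\<rparr>)"
      then have hk': "h \<in> H" "k \<in> H" "h \<otimes> k \<in> H" using subgroup.m_closed[OF H] by auto
      have "\<epsilon> (\<phi> (h \<otimes> k)) = \<epsilon> (\<phi> h \<otimes> \<phi> k)"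
        using hom_mult[OF U.conj_hom[OF u], of "\<epsilon> h" "\<epsilon> k"] hk' HG \<phi>H by (simp add: \<epsilon>\<phi>)
      then show "\<phi> (h \<otimes>\<^bsub>G\<lparr>carrier := H\<rparr>\<^esub> k) = \<phi> h \<otimes> \<phi> k"
        using inj_onD[OF inj] hk' HG \<phi>H by simp
    qed (use \<phi>H HG in auto)
    moreover have "\<exists>g \<in> carrier G. \<phi> h = g \<otimes> h \<otimes> inv g" if h: "h \<in> H" for h
      by (rule conj[OF u HG[OF h] HG[OF \<phi>H[OF h]]]) (use u h HG in \<open>simp add: \<epsilon>\<phi> U.m_assoc\<close>)
    ultimately have "inner_on \<phi> H" by (intro inner) (simp add: pointwise_inner_def)
    then obtain g where g: "g \<in> carrier G" "\<And>h. h \<in> H \<Longrightarrow> \<phi> h = g \<otimes> h \<otimes> inv g"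
      unfolding inner_on_def by blast
    have "\<epsilon> ` \<phi> ` H = \<epsilon> ` H" using uH by (simp add: image_image \<epsilon>\<phi>)
    moreover have "\<phi> ` H \<subseteq> carrier G" using \<phi>H HG by (auto simp: image_subset_iff)
    ultimately have "\<phi> ` H = H" using inj_on_image_eq_iff[OF inj _ Hsub] by simp
    moreover have "\<phi> ` H = (\<lambda>h. g \<otimes> h \<otimes> inv g) ` H" by (rule image_cong[OF refl g(2)])
    ultimately have gN: "g \<in> normalizer G H" using g(1) by (simp add: N_G)
    define c where "c = inv\<^bsub>U\<^esub> (\<epsilon> g) \<otimes>\<^bsub>U\<^esub> u"
    have cU: "c \<in> carrier U" using u g by (simp add: c_def)
    have u_eq: "u = \<epsilon> g \<otimes>\<^bsub>U\<^esub> c" using u g by (simp add: c_def flip: U.m_assoc)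
    have "c \<otimes>\<^bsub>U\<^esub> \<epsilon> h = \<epsilon> h \<otimes>\<^bsub>U\<^esub> c" if h: "h \<in> H" for h
    proof -
      have "\<epsilon> g \<otimes>\<^bsub>U\<^esub> (c \<otimes>\<^bsub>U\<^esub> \<epsilon> h \<otimes>\<^bsub>U\<^esub> inv\<^bsub>U\<^esub> c) \<otimes>\<^bsub>U\<^esub> inv\<^bsub>U\<^esub> (\<epsilon> g) =
          \<epsilon> g \<otimes>\<^bsub>U\<^esub> \<epsilon> h \<otimes>\<^bsub>U\<^esub> inv\<^bsub>U\<^esub> (\<epsilon> g)"
        using \<epsilon>\<phi>[OF h] U.conj_mult[of "\<epsilon> g" c "\<epsilon> h"] g h HG cU by (simp add: u_eq)
      then have "c \<otimes>\<^bsub>U\<^esub> \<epsilon> h \<otimes>\<^bsub>U\<^esub> inv\<^bsub>U\<^esub> c = \<epsilon> h" using g h HG cU by simp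
      then show ?thesis using U.conj_fixed_iff cU h HG by simp
    qed
    then have "c \<in> centralizer U (\<epsilon> ` H)" using cU by (simp add: centralizer_def)
    then show "u \<in> (\<epsilon> ` normalizer G H) <#>\<^bsub>U\<^esub> centralizer U (\<epsilon> ` H)"
      unfolding set_mult_def using gN u_eq by blast
  qed
qed

section \<open>Subgroups with two generators\<close>

lemma int_subgroup_principal:
  fixes S :: "int set"
  assumes "0 \<in> S" "\<And>x y. x \<in> S \<Longrightarrow> y \<in> S \<Longrightarrow> x - y \<in> S"
  shows "\<exists>d \<in> S. \<forall>k \<in> S. d dvd k"
proof -
  have "x \<in> S" if "x \<in> group_closure S" for x
    using that by induction (use assms in auto)
  then have "Gcd S \<in> S" using Gcd_in_group_closure by blast
  then show ?thesis by (meson Gcd_dvd)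
qed

lemma (in group) powers_in_subgroup:
  assumes "subgroup H G" "\<alpha> \<in> carrier G"
  shows "\<exists>d::int. \<alpha> [^] d \<in> H \<and> (\<forall>i::int. \<alpha> [^] i \<in> H \<longrightarrow> d dvd i)"
proof -
  have "\<exists>d \<in> {i::int. \<alpha> [^] i \<in> H}. \<forall>k \<in> {i::int. \<alpha> [^] i \<in> H}. d dvd k"
    by (rule int_subgroup_principal)
      (use assms in \<open>auto simp: int_pow_diff subgroup.one_closed subgroup.m_closed subgroup.m_inv_closed\<close>)
  then show ?thesis by auto
qed

text \<open>The common core of the three cases. Write \<open>a\<close> for a generator of the cyclic group $H \cap A$, with
  \<open>A\<close> the group of powers of \<open>\<alpha>\<close>. Some \<open>y\<close> conjugates \<open>b\<close> to \<open>\<phi> b\<close> and some \<open>g\<close> conjugates \<open>a\<close> to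
  \<open>\<phi> a\<close>; the point is to choose them equal. Multiplying \<open>g\<close> on the right by a power of \<open>\<alpha>\<close> does not change its
  effect on \<open>a\<close>, so \<open>inv y \<otimes> g\<close> may be taken to be a power of \<open>s\<close>, and powers of \<open>s\<close>
  commute with \<open>b\<close>. Hence \<open>g\<close> has the same effect on \<open>b\<close> as \<open>y\<close>.\<close>

lemma (in group) pointwise_inner_two_generators:
  fixes \<alpha> b s :: 'a
  assumes H: "subgroup H G" and \<phi>: "pointwise_inner \<phi> H"
    and \<alpha>: "\<alpha> \<in> carrier G" and s: "s \<in> carrier G"
    and G_gen: "\<And>g. g \<in> carrier G \<Longrightarrow> \<exists>(k::int) (i::int). g = s [^] k \<otimes> \<alpha> [^] i"
    and b: "b \<in> H" and sb: "s \<otimes> b = b \<otimes> s"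
    and H_gen: "\<And>h. h \<in> H \<Longrightarrow> \<exists>(l::int) (i::int). h = b [^] l \<otimes> \<alpha> [^] i"
  shows "inner_on \<phi> H"
proof -
  note hom = \<phi>[unfolded pointwise_inner_def, THEN conjunct1]
  have bG: "b \<in> carrier G" using b H subgroup.mem_carrier by metis
  obtain d :: int where d: "\<alpha> [^] d \<in> H" "\<And>i::int. \<alpha> [^] i \<in> H \<Longrightarrow> d dvd i"
    using powers_in_subgroup[OF H \<alpha>] by auto
  define a where "a = \<alpha> [^] d"
  have aH: "a \<in> H" and aG: "a \<in> carrier G" using d \<alpha> by (auto simp: a_def)
  obtain y where y: "y \<in> carrier G" "\<phi> b = y \<otimes> b \<otimes> inv y"
    using \<phi> b unfolding pointwise_inner_def by blast
  obtain g where g: "g \<in> carrier G" "\<phi> a = g \<otimes> a \<otimes> inv g"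
    using \<phi> aH unfolding pointwise_inner_def by blast
  obtain k i :: int where ki: "inv y \<otimes> g = s [^] k \<otimes> \<alpha> [^] i"
    using G_gen[of "inv y \<otimes> g"] y g by auto
  define x where "x = y \<otimes> s [^] k"
  have x: "x \<in> carrier G" using y s by (simp add: x_def)
  have "g = y \<otimes> (inv y \<otimes> g)" using y g by (simp flip: m_assoc)
  then have g_eq: "g = x \<otimes> \<alpha> [^] i" using ki y s \<alpha> by (simp add: x_def m_assoc)
  have "\<alpha> [^] i \<otimes> a = a \<otimes> \<alpha> [^] i"
    using \<alpha> by (simp add: a_def add.commute flip: int_pow_mult)
  then have xa: "\<phi> a = x \<otimes> a \<otimes> inv x"
    using g(2) x \<alpha> aG conj_fixed_iff[of "\<alpha> [^] i" a] unfolding g_eq by (simp add: conj_mult)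
  have "s [^] k \<otimes> b = b \<otimes> s [^] k" using int_pow_commute[OF sb s bG] .
  then have xb: "\<phi> b = x \<otimes> b \<otimes> inv x"
    using y bG s conj_fixed_iff[of "s [^] k" b] by (simp add: x_def conj_mult)
  have "\<phi> h = x \<otimes> h \<otimes> inv x" if h: "h \<in> H" for h
  proof -
    \<comment> \<open>the factor \<open>\<alpha> [^] j\<close> lies in \<open>H\<close>, hence is a power of \<open>a\<close>\<close>
    obtain l j :: int where lj: "h = b [^] l \<otimes> \<alpha> [^] j" using H_gen[OF h] by auto
    have bl: "b [^] l \<in> H" using subgroup_int_pow_closed[OF H b] .
    have "\<alpha> [^] j = inv (b [^] l) \<otimes> h" using lj bG \<alpha> by (simp flip: m_assoc)
    then have "\<alpha> [^] j \<in> H"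
      using bl h H by (simp add: subgroup.m_closed subgroup.m_inv_closed)
    then obtain w where w: "j = d * w" using d(2) by blast
    have h_eq: "h = b [^] l \<otimes> a [^] w" using lj \<alpha> by (simp add: a_def w int_pow_pow)
    have "\<phi> h = \<phi> b [^] l \<otimes> \<phi> a [^] w"
      unfolding h_eq using hom_mult[OF hom, of "b [^] l" "a [^] w"] bl
      using subgroup_int_pow_closed[OF H aH, of w] hom_subgroup_int_pow[OF H hom] b aH by simp
    also have "\<dots> = (x \<otimes> b [^] l \<otimes> inv x) \<otimes> (x \<otimes> a [^] w \<otimes> inv x)"
      unfolding xa xb using x aG bG by (simp add: conj_int_pow)
    also have "\<dots> = x \<otimes> h \<otimes> inv x"
      unfolding h_eq using hom_mult[OF conj_hom[OF x], of "b [^] l" "a [^] w"] aG bG by simp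
    finally show ?thesis .
  qed
  with x show ?thesis unfolding inner_on_def by blast
qed

lemma (in group) pointwise_inner_cyclic:
  assumes H: "subgroup H G" and \<phi>: "pointwise_inner \<phi> H"
    and b: "b \<in> H" and H_gen: "\<And>h. h \<in> H \<Longrightarrow> \<exists>l::int. h = b [^] l"
  shows "inner_on \<phi> H"
proof -
  note hom = \<phi>[unfolded pointwise_inner_def, THEN conjunct1]
  have bG: "b \<in> carrier G" using b H subgroup.mem_carrier by metis
  obtain g where g: "g \<in> carrier G" "\<phi> b = g \<otimes> b \<otimes> inv g"
    using \<phi> b unfolding pointwise_inner_def by blast
  have "\<phi> h = g \<otimes> h \<otimes> inv g" if "h \<in> H" for h
    using H_gen[OF that] hom_subgroup_int_pow[OF H hom b] g bG by (auto simp: conj_int_pow)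
  with g show ?thesis unfolding inner_on_def by blast
qed

section \<open>Extensions of cyclic groups by cyclic groups\<close>

lemma geometric_sum_cong:
  fixes r g :: int and n :: nat
  assumes "g dvd r - 1"
  shows "[(\<Sum>l<n. r ^ l) = int n] (mod g)"
proof -
  have "[r = 1] (mod g)" using assms by (simp add: cong_iff_dvd_diff)
  then have "[(\<Sum>l<n. r ^ l) = (\<Sum>l<n. 1 ^ l)] (mod g)" by (intro cong_sum cong_pow)
  then show ?thesis by simp
qed

text \<open>Taking \<open>integer_mod_group n\<close> as the quotient covers the infinite cyclic quotient as well, by \<open>n = 0\<close>; since \<open>x mod 0 = x\<close>, the
  arithmetic of \<open>\<pi>\<close> is uniform in \<open>n\<close>.\<close>

locale cyclic_extension = group G for G (structure) +
  fixes n :: nat and \<pi> :: "'a \<Rightarrow> int" and \<alpha> :: 'a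
  assumes \<pi>_epi: "\<pi> \<in> epi G (integer_mod_group n)"
    and \<alpha>_closed [simp]: "\<alpha> \<in> carrier G"
    and kernel_\<pi>: "kernel G (integer_mod_group n) \<pi> = range (\<lambda>i::int. \<alpha> [^] i)"
begin

lemma \<pi>_hom: "\<pi> \<in> hom G (integer_mod_group n)"
  using \<pi>_epi by (simp add: epi_def)

lemma \<pi>_mod: "x \<in> carrier G \<Longrightarrow> \<pi> x mod int n = \<pi> x"
  using hom_in_carrier[OF \<pi>_hom, of x] by (auto simp: carrier_integer_mod_group split: if_splits)

lemma \<pi>_mult: "x \<in> carrier G \<Longrightarrow> y \<in> carrier G \<Longrightarrow> \<pi> (x \<otimes> y) = (\<pi> x + \<pi> y) mod int n"
  using hom_mult[OF \<pi>_hom] by simp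

lemma \<pi>_pow: "x \<in> carrier G \<Longrightarrow> \<pi> (x [^] (k::int)) = (k * \<pi> x) mod int n"
  using hom_int_pow[OF \<pi>_hom, of x k] by (simp add: is_group int_pow_integer_mod_group)

lemma \<pi>_inv: "x \<in> carrier G \<Longrightarrow> \<pi> (inv x) = (- \<pi> x) mod int n"
  using \<pi>_pow[of x "-1"] int_pow_neg[of x 1] by simp

lemma \<pi>_zero_iff: "x \<in> carrier G \<Longrightarrow> \<pi> x = 0 \<longleftrightarrow> (\<exists>i::int. x = \<alpha> [^] i)"
proof -
  assume "x \<in> carrier G"
  then have "\<pi> x = 0 \<longleftrightarrow> x \<in> kernel G (integer_mod_group n) \<pi>" by (simp add: kernel_def)
  then show ?thesis unfolding kernel_\<pi> by blast
qed

lemma \<pi>_eq_coset: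
  assumes "x \<in> carrier G" "y \<in> carrier G" "\<pi> x = \<pi> y"
  shows "\<exists>i::int. x = y \<otimes> \<alpha> [^] i"
proof -
  have "\<pi> (inv y \<otimes> x) = 0"
    using assms by (simp add: \<pi>_mult \<pi>_inv mod_add_left_eq)
  then obtain i :: int where "inv y \<otimes> x = \<alpha> [^] i" using assms \<pi>_zero_iff by fastforce
  then have "x = y \<otimes> \<alpha> [^] i" using assms by (simp add: inv_solve_left')
  then show ?thesis ..
qed

lemma ex_\<pi>_one: "\<exists>t \<in> carrier G. \<pi> t = 1 mod int n"
proof -
  have "1 mod int n \<in> carrier (integer_mod_group n)"
    by (simp add: carrier_integer_mod_group)
  then have "1 mod int n \<in> \<pi> ` carrier G" using \<pi>_epi by (simp add: epi_def)
  then show ?thesis by (metis imageE)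
qed

lemma generated_by_coset_generator:
  assumes s: "s \<in> carrier G" and e: "[\<pi> s * e = 1] (mod int n)" and g: "g \<in> carrier G"
  shows "\<exists>(k::int) (i::int). g = s [^] k \<otimes> \<alpha> [^] i"
proof -
  have "[e * \<pi> g * \<pi> s = 1 * \<pi> g] (mod int n)"
    using cong_scalar_right[OF e, of "\<pi> g"] by (simp add: ac_simps)
  then have "\<pi> g = \<pi> (s [^] (e * \<pi> g))"
    using \<pi>_mod[OF g] s by (simp add: \<pi>_pow cong_def)
  then show ?thesis using \<pi>_eq_coset[OF g, of "s [^] (e * \<pi> g)"] s by blast
qed

lemma subgroup_coset_generator:
  assumes H: "subgroup H G"
  shows "\<exists>b \<in> H. \<forall>h \<in> H. \<exists>l::int. \<pi> h = (l * \<pi> b) mod int n"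
proof -
  note HG = subgroup.mem_carrier[OF H]
  \<comment> \<open>the preimage in the integers of the image of \<open>H\<close> in the quotient\<close>
  let ?S = "{k. \<exists>h \<in> H. \<pi> h = k mod int n}"
  have "\<exists>d \<in> ?S. \<forall>k \<in> ?S. d dvd k"
  proof (rule int_subgroup_principal)
    have "\<pi> \<one> = 0" using \<pi>_zero_iff[of \<one>] by (metis int_pow_0 one_closed)
    then show "0 \<in> ?S" using subgroup.one_closed[OF H] by force
    fix x y assume "x \<in> ?S" "y \<in> ?S"
    then obtain h h' where h: "h \<in> H" "\<pi> h = x mod int n" "h' \<in> H" "\<pi> h' = y mod int n" by auto
    have "\<pi> (h \<otimes> inv h') = (x - y) mod int n"
      using h HG by (simp add: \<pi>_mult \<pi>_inv mod_simps)
    then show "x - y \<in> ?S"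
      using h subgroup.m_closed[OF H] subgroup.m_inv_closed[OF H] by blast
  qed
  then obtain d b where d: "\<And>k. k \<in> ?S \<Longrightarrow> d dvd k" and b: "b \<in> H" "\<pi> b = d mod int n" by blast
  have "\<exists>l::int. \<pi> h = (l * \<pi> b) mod int n" if h: "h \<in> H" for h
  proof -
    have "\<pi> h \<in> ?S" using h HG[OF h] \<pi>_mod by force
    then obtain l where "\<pi> h = d * l" using d by blast
    then show ?thesis using \<pi>_mod[OF HG[OF h]] b(2)
      by (metis mod_mult_right_eq mult.commute)
  qed
  with b show ?thesis by blast
qed

lemma subgroup_generated:
  assumes "h \<in> carrier G" "b \<in> carrier G" "\<exists>l::int. \<pi> h = (l * \<pi> b) mod int n"
  shows "\<exists>(l::int) (i::int). h = b [^] l \<otimes> \<alpha> [^] i"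
proof -
  obtain l :: int where "\<pi> h = \<pi> (b [^] l)" using assms by (auto simp: \<pi>_pow)
  then show ?thesis using \<pi>_eq_coset[OF assms(1) int_pow_closed[OF assms(2)]] by blast
qed

text \<open>Either \<open>H\<close> lies in the kernel of \<open>\<pi>\<close> and is cyclic, or it contains some \<open>b\<close> outside the kernel. In the second case
  the quotient, being of prime order, is generated by the image of \<open>b\<close>, so that \<open>b\<close> itself can play the
  role of the element \<open>s\<close> that commutes with \<open>b\<close>.\<close>

lemma pointwise_inner_prime_quotient:
  assumes prime: "Factorial_Ring.prime n" and H: "subgroup H G" and \<phi>: "pointwise_inner \<phi> H"
  shows "inner_on \<phi> H"
proof (cases "\<forall>h \<in> H. \<pi> h = 0")
  case True
  obtain t where t: "t \<in> carrier G" "\<pi> t = 1 mod int n" using ex_\<pi>_one by blast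
  show ?thesis
  proof (rule pointwise_inner_two_generators[OF H \<phi> \<alpha>_closed t(1)])
    show "\<exists>(k::int) (i::int). g = t [^] k \<otimes> \<alpha> [^] i" if "g \<in> carrier G" for g
      by (rule generated_by_coset_generator[OF t(1) _ that, of 1]) (simp add: t cong_def)
    \<comment> \<open>\<open>H\<close> lies in the kernel, so the second generator is trivial\<close>
    show "\<one> \<in> H" using H by (rule subgroup.one_closed)
    show "\<exists>(l::int) (i::int). h = \<one> [^] l \<otimes> \<alpha> [^] i" if "h \<in> H" for h
      using True that \<pi>_zero_iff[OF subgroup.mem_carrier[OF H that]] by auto
  qed (use t in auto)
next
  case False
  then obtain b where b: "b \<in> H" "\<pi> b \<noteq> 0" by blast
  have bG: "b \<in> carrier G" using b H subgroup.mem_carrier by metis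
  have "\<not> int n dvd \<pi> b" using b(2) \<pi>_mod[OF bG] by (metis dvd_imp_mod_0)
  then have "coprime (\<pi> b) (int n)"
    using prime prime_imp_coprime[of "int n" "\<pi> b"] by (simp add: coprime_commute)
  then obtain e where e: "[\<pi> b * e = 1] (mod int n)" using cong_solve_coprime_int by blast
  note gen = generated_by_coset_generator[OF bG e]
  show ?thesis
  proof (rule pointwise_inner_two_generators[OF H \<phi> \<alpha>_closed bG gen b(1) refl])
    show "\<exists>(l::int) (i::int). h = b [^] l \<otimes> \<alpha> [^] i" if "h \<in> H" for h
      by (rule gen[OF subgroup.mem_carrier[OF H that]])
  qed
qed

text \<open>As the order of the kernel divides a prime, \<open>H\<close> contains the kernel or meets it trivially. In the first case \<open>H\<close> contains
  a power \<open>t [^] k\<close> of a lift \<open>t\<close> of the generator of the quotient as its second generator, and \<open>t\<close>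
  commutes with its own powers. In the second case \<open>H\<close> embeds in the quotient and is cyclic.\<close>

lemma pointwise_inner_prime_kernel:
  assumes prime: "Factorial_Ring.prime p" and \<alpha>p: "\<alpha> [^] (p::int) = \<one>"
    and H: "subgroup H G" and \<phi>: "pointwise_inner \<phi> H"
  shows "inner_on \<phi> H"
proof -
  note HG = subgroup.mem_carrier[OF H]
  obtain b where b: "b \<in> H" "\<And>h. h \<in> H \<Longrightarrow> \<exists>l::int. \<pi> h = (l * \<pi> b) mod int n"
    using subgroup_coset_generator[OF H] by blast
  note bG = HG[OF b(1)]
  show ?thesis
  proof (cases "\<alpha> \<in> H")
    case True
    obtain t where t: "t \<in> carrier G" "\<pi> t = 1 mod int n" using ex_\<pi>_one by blast
    let ?c = "t [^] \<pi> b"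
    have \<pi>c: "\<pi> ?c = \<pi> b"
      using t \<pi>_mod[OF bG] by (simp add: \<pi>_pow mod_mult_right_eq)
    then obtain i :: int where "?c = b \<otimes> \<alpha> [^] i"
      using \<pi>_eq_coset[of ?c b] t bG by auto
    then have c: "?c \<in> H"
      using subgroup.m_closed[OF H b(1) subgroup_int_pow_closed[OF H True]] by simp
    show ?thesis
    proof (rule pointwise_inner_two_generators[OF H \<phi> \<alpha>_closed t(1) _ c])
      show "\<exists>(k::int) (i::int). g = t [^] k \<otimes> \<alpha> [^] i" if "g \<in> carrier G" for g
        by (rule generated_by_coset_generator[OF t(1) _ that, of 1]) (simp add: t cong_def)
      show "t \<otimes> ?c = ?c \<otimes> t"
        using int_pow_commute[OF refl t(1) t(1)] by simp
      show "\<exists>(l::int) (i::int). h = ?c [^] l \<otimes> \<alpha> [^] i" if "h \<in> H" for h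
        by (rule subgroup_generated[OF HG[OF that] HG[OF c]]) (use b(2)[OF that] \<pi>c in simp)
    qed
  next
    case False
    have triv: "\<alpha> [^] i = \<one>" if i: "\<alpha> [^] i \<in> H" for i :: int
    proof (rule ccontr)
      assume ne: "\<alpha> [^] i \<noteq> \<one>"
      have "\<not> p dvd i"
      proof
        assume "p dvd i"
        then obtain w where "i = p * w" ..
        then have "\<alpha> [^] i = (\<alpha> [^] p) [^] w" by (simp add: int_pow_pow)
        with ne \<alpha>p show False by simp
      qed
      then have "coprime i p" using prime prime_imp_coprime[of p i] by (simp add: coprime_commute)
      then obtain e where "[i * e = 1] (mod p)" using cong_solve_coprime_int by blast
      then obtain w where "1 = i * e + p * w" by (metis cong_iff_lin)
      then have "\<alpha> = \<alpha> [^] (i * e + p * w)" by (metis int_pow_1 \<alpha>_closed)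
      also have "\<dots> = (\<alpha> [^] i) [^] e \<otimes> (\<alpha> [^] p) [^] w" by (simp add: int_pow_mult int_pow_pow)
      also have "\<dots> = (\<alpha> [^] i) [^] e" using \<alpha>p by simp
      finally show False using False subgroup_int_pow_closed[OF H i, of e] by simp
    qed
    show ?thesis
    proof (rule pointwise_inner_cyclic[OF H \<phi> b(1)])
      fix h assume h: "h \<in> H"
      then obtain l i :: int where hl: "h = b [^] l \<otimes> \<alpha> [^] i"
        using subgroup_generated[OF HG[OF h] bG b(2)[OF h]] by blast
      have "\<alpha> [^] i = inv (b [^] l) \<otimes> h" using hl bG by (simp flip: m_assoc)
      then have "\<alpha> [^] i = \<one>"
        using h H subgroup_int_pow_closed[OF H b(1), of l]
        by (intro triv) (simp add: subgroup.m_closed subgroup.m_inv_closed)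
      then show "\<exists>l::int. h = b [^] l" using hl bG by auto
    qed
  qed
qed

lemma \<pi>_conj:
  assumes "t \<in> carrier G" "b \<in> carrier G"
  shows "\<pi> (t \<otimes> b \<otimes> inv t) = \<pi> b"
  using assms \<pi>_mod[of b] by (simp add: \<pi>_mult \<pi>_inv mod_simps)

lemma conj_\<alpha>_pow:
  assumes "b \<in> carrier G"
  shows "\<exists>r::int. \<forall>j::int. b \<otimes> \<alpha> [^] j = \<alpha> [^] (r * j) \<otimes> b"
proof -
  have "\<pi> (b \<otimes> \<alpha> \<otimes> inv b) = 0"
    using \<pi>_conj[OF assms \<alpha>_closed] \<pi>_zero_iff[of \<alpha>] by (metis \<alpha>_closed int_pow_1)
  then obtain r :: int where r: "b \<otimes> \<alpha> \<otimes> inv b = \<alpha> [^] r"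
    using \<pi>_zero_iff assms by auto
  have "b \<otimes> \<alpha> [^] j = \<alpha> [^] (r * j) \<otimes> b" for j :: int
    using conj_int_pow[OF assms \<alpha>_closed, of j] assms unfolding r
    by (simp add: int_pow_pow inv_solve_right)
  then show ?thesis by blast
qed

text \<open>The norm formula for the action of \<open>b\<close> on the powers of \<open>\<alpha>\<close> by \<open>r\<close>-th powers.\<close>

lemma pow_twisted:
  fixes r i :: int and k :: nat
  assumes b: "b \<in> carrier G" and r: "\<And>j::int. b \<otimes> \<alpha> [^] j = \<alpha> [^] (r * j) \<otimes> b"
  shows "(\<alpha> [^] i \<otimes> b) [^] k = \<alpha> [^] (i * (\<Sum>l<k. r ^ l)) \<otimes> b [^] k"
proof (induction k)
  case (Suc k)
  let ?S = "\<Sum>l<k. r ^ l"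
  have "(\<alpha> [^] i \<otimes> b) [^] Suc k = (\<alpha> [^] i \<otimes> b) \<otimes> (\<alpha> [^] (i * ?S) \<otimes> b [^] k)"
    using b Suc nat_pow_Suc2[of "\<alpha> [^] i \<otimes> b" k] by (simp del: nat_pow_Suc)
  also have "\<dots> = \<alpha> [^] i \<otimes> (b \<otimes> \<alpha> [^] (i * ?S)) \<otimes> b [^] k"
    using b by (simp add: m_assoc)
  also have "\<dots> = (\<alpha> [^] i \<otimes> \<alpha> [^] (r * (i * ?S))) \<otimes> (b \<otimes> b [^] k)"
    using b by (simp add: r m_assoc)
  also have "\<dots> = \<alpha> [^] (i + r * (i * ?S)) \<otimes> b [^] Suc k"
    using b nat_pow_Suc2[of b k] by (simp add: int_pow_mult del: nat_pow_Suc)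
  also have "i + r * (i * ?S) = i * (\<Sum>l<Suc k. r ^ l)"
    by (simp add: sum.lessThan_Suc_shift sum_distrib_left algebra_simps del: sum.lessThan_Suc)
  finally show ?case .
qed (use b in simp)

text \<open>This replaces the conjugacy part of the Schur-Zassenhaus theorem. In the coset of \<open>t\<close>, look for
  \<open>s = \<alpha> [^] j \<otimes> t\<close> commuting with \<open>b\<close>. With \<open>t b t\<^sup>-\<^sup>1 = \<alpha>\<^sup>i b\<close> and \<open>b\<close> acting by \<open>r\<close>-th powers, this amounts to
  \<open>j (r - 1) = i\<close> modulo \<open>m\<close>, which is solvable as soon as \<open>g = gcd (r - 1) m\<close> divides \<open>i\<close>. Now
  \<open>\<alpha>\<^sup>i b\<close> has trivial \<open>n\<close>-th power, as a conjugate of \<open>b\<close>, so \<open>m\<close> divides \<open>i (1 + r + \<dots> + r\<^sup>n\<^sup>-\<^sup>1)\<close>. Modulo \<open>g\<close> the sum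
  is \<open>n\<close>, which is a unit there by coprimality.\<close>

lemma ex_commuting_in_coset:
  fixes m :: int
  assumes \<alpha>_ord: "\<And>i::int. \<alpha> [^] i = \<one> \<longleftrightarrow> m dvd i" and cop: "coprime m (int n)"
    and b: "b \<in> carrier G" "b [^] n = \<one>" and t: "t \<in> carrier G"
  shows "\<exists>s \<in> carrier G. \<pi> s = \<pi> t \<and> s \<otimes> b = b \<otimes> s"
proof -
  obtain r :: int where r: "\<And>j::int. b \<otimes> \<alpha> [^] j = \<alpha> [^] (r * j) \<otimes> b"
    using conj_\<alpha>_pow[OF b(1)] by blast
  let ?f = "t \<otimes> b \<otimes> inv t \<otimes> inv b"
  have "\<pi> ?f = 0"
    using t b \<pi>_conj[OF t b(1)] by (simp add: \<pi>_mult[of "t \<otimes> b \<otimes> inv t" "inv b"] \<pi>_inv mod_simps)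
  then obtain i :: int where "?f = \<alpha> [^] i" using \<pi>_zero_iff[of ?f] t b by auto
  then have i: "t \<otimes> b \<otimes> inv t = \<alpha> [^] i \<otimes> b"
    using t b by (simp add: inv_solve_right')
  have "(\<alpha> [^] i \<otimes> b) [^] n = \<one>"
    using conj_int_pow[OF t b(1), of "int n"] t b unfolding i by (simp add: int_pow_int)
  then have "m dvd i * (\<Sum>l<n. r ^ l)"
    using pow_twisted[OF b(1) r, where i = i and k = n] b(2) by (simp flip: \<alpha>_ord)
  define g where "g = gcd (r - 1) m"
  have "g dvd i * (\<Sum>l<n. r ^ l)"
    using \<open>m dvd i * _\<close> by (metis g_def gcd_dvd2 dvd_trans)
  moreover have "[i * (\<Sum>l<n. r ^ l) = i * int n] (mod g)"
    by (intro cong_scalar_left geometric_sum_cong) (simp add: g_def)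
  ultimately have "g dvd i * int n" by (simp add: cong_dvd_iff)
  moreover have "coprime g (int n)"
    using cop by (metis g_def gcd_dvd2 coprime_divisors dvd_refl)
  ultimately have "g dvd i" by (simp add: coprime_dvd_mult_left_iff)
  then obtain w where w: "i = g * w" ..
  obtain u v where uv: "u * (r - 1) + v * m = g" unfolding g_def using bezout_int by metis
  define j where "j = u * w"
  have "(j + i) - r * j = m * (v * w)"
    unfolding w j_def uv[symmetric] by (simp add: algebra_simps)
  then have "\<alpha> [^] ((j + i) - r * j) = \<one>" by (simp add: \<alpha>_ord)
  then have ji: "\<alpha> [^] (j + i) = \<alpha> [^] (r * j)"
    by (simp add: int_pow_diff inv_solve_right')
  let ?s = "\<alpha> [^] j \<otimes> t"
  have tb: "t \<otimes> b = \<alpha> [^] i \<otimes> b \<otimes> t"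
    using i t b by (simp add: inv_solve_right')
  have "?s \<otimes> b = \<alpha> [^] j \<otimes> (t \<otimes> b)" using t b by (simp add: m_assoc)
  also have "\<dots> = \<alpha> [^] (j + i) \<otimes> b \<otimes> t" unfolding tb using t b by (simp add: int_pow_mult m_assoc)
  also have "\<dots> = b \<otimes> \<alpha> [^] j \<otimes> t" by (simp add: ji r)
  also have "\<dots> = b \<otimes> ?s" using t b by (simp add: m_assoc)
  finally have "?s \<otimes> b = b \<otimes> ?s" .
  moreover have "\<pi> (\<alpha> [^] j) = 0" using \<pi>_zero_iff by auto
  then have "\<pi> ?s = \<pi> t" using t \<pi>_mod[OF t] by (simp add: \<pi>_mult)
  ultimately show ?thesis using t by (intro bexI[of _ ?s]) auto
qed

text \<open>The second generator \<open>b\<close> of \<open>H\<close> can be replaced by a power in the same coset of the kernel whose \<open>n\<close>-th power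
  is trivial, and for such a generator the coset of any lift of the generator of the quotient contains an
  element commuting with it.\<close>

lemma pointwise_inner_coprime:
  fixes m :: int
  assumes \<alpha>_ord: "\<And>i::int. \<alpha> [^] i = \<one> \<longleftrightarrow> m dvd i" and cop: "coprime m (int n)"
    and H: "subgroup H G" and \<phi>: "pointwise_inner \<phi> H"
  shows "inner_on \<phi> H"
proof -
  note HG = subgroup.mem_carrier[OF H]
  obtain b where b: "b \<in> H" "\<And>h. h \<in> H \<Longrightarrow> \<exists>l::int. \<pi> h = (l * \<pi> b) mod int n"
    using subgroup_coset_generator[OF H] by blast
  note bG = HG[OF b(1)]
  obtain e where e: "[m * e = 1] (mod int n)" using cop cong_solve_coprime_int by blast
  \<comment> \<open>congruent to \<open>b\<close> modulo the kernel by the choice of \<open>e\<close>, while the factor \<open>m\<close> kills its \<open>n\<close>-th power\<close>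
  let ?c = "b [^] (m * e)"
  have c: "?c \<in> H" by (rule subgroup_int_pow_closed[OF H b(1)])
  have \<pi>c: "\<pi> ?c = \<pi> b"
    using cong_scalar_right[OF e, of "\<pi> b"] \<pi>_mod[OF bG] bG by (simp add: \<pi>_pow cong_def)
  have "\<pi> (b [^] int n) = 0" using bG by (simp add: \<pi>_pow)
  then obtain i :: int where i: "b [^] int n = \<alpha> [^] i" using \<pi>_zero_iff bG by auto
  have "?c [^] int n = (b [^] int n) [^] (m * e)" using bG by (simp add: int_pow_pow mult.commute)
  also have "\<dots> = \<alpha> [^] (m * (i * e))" unfolding i by (simp add: int_pow_pow ac_simps)
  also have "\<dots> = \<one>" by (simp add: \<alpha>_ord)
  finally have cn: "?c [^] n = \<one>" by (simp add: int_pow_int)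
  obtain t where t: "t \<in> carrier G" "\<pi> t = 1 mod int n" using ex_\<pi>_one by blast
  obtain s where s: "s \<in> carrier G" "\<pi> s = \<pi> t" "s \<otimes> ?c = ?c \<otimes> s"
    using ex_commuting_in_coset[OF \<alpha>_ord cop HG[OF c] cn t(1)] by blast
  show ?thesis
  proof (rule pointwise_inner_two_generators[OF H \<phi> \<alpha>_closed s(1) _ c s(3)])
    show "\<exists>(k::int) (i::int). g = s [^] k \<otimes> \<alpha> [^] i" if "g \<in> carrier G" for g
      by (rule generated_by_coset_generator[OF s(1) _ that, of 1]) (simp add: s t cong_def)
    show "\<exists>(l::int) (i::int). h = ?c [^] l \<otimes> \<alpha> [^] i" if "h \<in> H" for h
      by (rule subgroup_generated[OF HG[OF that] HG[OF c]]) (use b(2)[OF that] \<pi>c in simp)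
  qed
qed

end

section \<open>Normalizers in group rings of metacyclic groups\<close>

text \<open>As \<open>integer_mod_group 0\<close> is the infinite cyclic group, one family of groups indexed by natural numbers covers
  every \<open>k\<close>.\<close>

lemma cyclic_grp_eq: "\<exists>j. cyclic_grp k = integer_mod_group j \<and> (\<forall>i. k = enat i \<longrightarrow> j = i)"
proof (cases k)
  case infinity
  then show ?thesis by (auto simp: cyclic_grp_def integer_mod_group_def intro: exI[of _ 0])
qed (auto simp: cyclic_grp_def)

lemma (in group) mon_integer_mod_group_powers:
  assumes \<iota>: "\<iota> \<in> mon (integer_mod_group m) G" and "\<alpha> = \<iota> (1 mod int m)"
  shows "\<alpha> \<in> carrier G" "\<And>i::int. \<alpha> [^] i = \<one> \<longleftrightarrow> int m dvd i"
    "\<iota> ` carrier (integer_mod_group m) = range (\<lambda>i::int. \<alpha> [^] i)"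
proof -
  let ?Z = "integer_mod_group m"
  have hom: "\<iota> \<in> hom ?Z G" and inj: "inj_on \<iota> (carrier ?Z)" using \<iota> by (auto simp: mon_def)
  have mod_in: "i mod int m \<in> carrier ?Z" for i
    by (simp add: carrier_integer_mod_group)
  show "\<alpha> \<in> carrier G" using hom_in_carrier[OF hom mod_in] assms(2) by simp
  have pow: "\<alpha> [^] i = \<iota> (i mod int m)" for i :: int
    using hom_int_pow[OF hom mod_in[of 1], of i]
    by (simp add: assms(2) is_group int_pow_integer_mod_group mod_mult_right_eq)
  have "\<iota> 0 = \<one>" using hom_one[OF hom] by (simp add: is_group)
  then have "\<alpha> [^] i = \<one> \<longleftrightarrow> \<iota> (i mod int m) = \<iota> 0" for i :: int by (simp add: pow)
  also have "\<dots> i \<longleftrightarrow> i mod int m = 0" for i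
    using inj_on_eq_iff[OF inj mod_in[of i] integer_mod_group_0] .
  finally show "\<alpha> [^] i = \<one> \<longleftrightarrow> int m dvd i" for i :: int by (simp add: dvd_eq_mod_eq_0)
  have "x = x mod int m" if "x \<in> carrier ?Z" for x
    using that by (auto simp: carrier_integer_mod_group split: if_splits)
  then have "carrier ?Z = range (\<lambda>i. i mod int m)" using mod_in by blast
  then show "\<iota> ` carrier ?Z = range (\<lambda>i::int. \<alpha> [^] i)" by (simp add: pow image_image)
qed

theorem theorem11:
  fixes R :: "('r, 'a) ring_scheme" and G :: "('g, 'b) monoid_scheme"
    and m n :: enat and \<iota> :: "int \<Rightarrow> 'g" and \<pi> :: "'g \<Rightarrow> int" and H :: "'g set"
  assumes "1 \<le> m" and "1 \<le> n"
    and "group G"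
    and "\<iota> \<in> mon (cyclic_grp m) G"
    and "\<pi> \<in> epi G (cyclic_grp n)"
    and "\<iota> ` carrier (cyclic_grp m) = kernel G (cyclic_grp n) \<pi>"
    and "cring R" and "\<one>\<^bsub>R\<^esub> \<noteq> \<zero>\<^bsub>R\<^esub>"
    and "(\<exists>a b. m = enat a \<and> n = enat b \<and> coprime a b) \<or>
         (\<exists>q. n = enat q \<and> Factorial_Ring.prime q) \<or>
         (\<exists>p. m = enat p \<and> Factorial_Ring.prime p)"
    and "subgroup H G"
  shows "normalizer (units_of (group_ring R G)) (group_elt R ` H) =
         (group_elt R ` normalizer G H)
           <#>\<^bsub>units_of (group_ring R G)\<^esub>
         centralizer (units_of (group_ring R G)) (group_elt R ` H)"
proof -
  interpret group_ring_setup R G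
    using assms(3,7) by (simp add: group_ring_setup_def)
  interpret RG: ring RG by (rule ring_group_ring)
  obtain m' where m': "cyclic_grp m = integer_mod_group m'" "\<And>i. m = enat i \<Longrightarrow> m' = i"
    using cyclic_grp_eq by metis
  obtain n' where n': "cyclic_grp n = integer_mod_group n'" "\<And>i. n = enat i \<Longrightarrow> n' = i"
    using cyclic_grp_eq by metis
  define \<alpha> where "\<alpha> = \<iota> (1 mod int m')"
  note \<alpha> = G.mon_integer_mod_group_powers[OF assms(4)[unfolded m'(1)] \<alpha>_def]
  interpret cyclic_extension G n' \<pi> \<alpha>
    by unfold_locales (use assms(5,6) \<alpha> in \<open>auto simp: m' n'\<close>)
  have inner: "G.inner_on \<phi> H" if "G.pointwise_inner \<phi> H" for \<phi>
    using assms(9)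
  proof (elim disjE exE conjE)
    fix a b assume "m = enat a" "n = enat b" "coprime a b"
    then have "coprime (int m') (int n')" by (simp add: m'(2) n'(2))
    then show ?thesis using pointwise_inner_coprime[OF \<alpha>(2) _ assms(10) that] by blast
  next
    fix q assume "n = enat q" "Factorial_Ring.prime q"
    then show ?thesis using pointwise_inner_prime_quotient[OF _ assms(10) that] by (simp add: n'(2))
  next
    fix p assume "m = enat p" "Factorial_Ring.prime p"
    then have "Factorial_Ring.prime (int m')" by (simp add: m'(2))
    then show ?thesis using pointwise_inner_prime_kernel[of "int m'", OF _ _ assms(10) that] \<alpha>(2)[of "int m'"] by simp
  qed
  show ?thesis
  proof (rule G.normalizer_eq_normalizer_centralizer[OF RG.units_group group_elt_mon[OF assms(8)] assms(10) _ inner])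
    fix u h k assume "u \<in> carrier (units_of RG)" "h \<in> carrier G" "k \<in> carrier G"
      "u \<otimes>\<^bsub>units_of RG\<^esub> group_elt R h = group_elt R k \<otimes>\<^bsub>units_of RG\<^esub> u"
    then show "\<exists>g \<in> carrier G. k = g \<otimes>\<^bsub>G\<^esub> h \<otimes>\<^bsub>G\<^esub> inv\<^bsub>G\<^esub> g"
      using conjugate_in_units_imp_conjugate[OF assms(8)] by (simp add: units_of_def)
  qed
qed

end
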